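(* For all integers $m\ge 1$ and $n \ge 1$, $$\operatorname{Cat}^{(m)}(W_{A_{n-1}},q) = \operatorname{Cat}^{(m)}_n(q) \qquad\text{and}\qquad \operatorname{Cat}^{(1)}(W_{B_n},q) = \operatorname{Cat}_{B_n}(q).$$
   Context: Shi arrangement setting: for a crystallographic root system $\Phi$ spanning a real vector space $V$ with inner product $(\,,\,)$, with positive roots $\Phi^+$, $N:=\#\Phi^+$, and an integer $m\ge1$, the extended Shi arrangement $\mathsf{Shi}^{(m)}(\Phi)$ consists of the hyperplanes $(\alpha,x)=k$ for $\alpha\in\Phi$ and integers $-m<k\le m$. A positive region is a connected component of the complement of these hyperplanes contained in $\{x:(\alpha,x)>0\ \forall\alpha\in\Phi^+\}$. The fundamental region is $R^0=\{x:0<(\alpha,x)<1\ \forall \alpha\in\Phi^+\}$; the height $\operatorname{h}(R)$ of a region is the number of hyperplanes of the arrangement separating $R$ from $R^0$, and $\operatorname{coh}(R):=mN-\operatorname{h}(R)$. For $W=W_\Phi$ define $\operatorname{Cat}^{(m)}(W,q):=\sum_R q^{\operatorname{coh}(R)}$ over all positive regions $R$. Here $W_{A_{n-1}}$ uses the root system $A_{n-1}$ (positive roots $e_i-e_j$, $1\le i<j\le n$) and $W_{B_n}$ the root system $B_n$ (positive roots $e_i\pm e_j$ for $i<j$ and $e_i$). Type $A$ paths: $\mathcal{D}^{(m)}_n$ is the set of integer partitions $\lambda$ fitting inside the partition $((n-1)m,\ldots,2m,m)$ (i.e. $\lambda_i \le (n-i)m$), $\operatorname{area}(\lambda) := m\binom{n}{2}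 - |\lambda|$ (the number of full cells between the corresponding $m$-Catalan lattice path and the boundary staircase), and $\operatorname{Cat}^{(m)}_n(q) := \sum_{\lambda\in\mathcal{D}^{(m)}_n} q^{\operatorname{area}(\lambda)}$. Type $B$ paths: a unit square is $[a,a+1]\times[b,b+1]$ with $a,b$ nonnegative integers. A type $B$ Catalan path of length $n$ is a lattice path of $2n$ unit steps, each north or east, from $(0,0)$, never going below the line $y=x$. Its area is the number of unit squares in the region bounded by the path, the diagonal $y=x$ and the anti-diagonal $x+y=2n$, where the half-squares cut by $y=x$ are not counted but the half-squares cut by $x+y=2n$ are counted. $\operatorname{Cat}_{B_n}(q):=\sum_\lambda q^{\operatorname{area}(\lambda)}$ over all type $B$ Catalan paths of length $n$. *)

theory Defs
  imports "HOL-Analysis.Analysis" "HOL-Computational_Algebra.Polynomial"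
begin

text \<open>
  A root system enters through its set \<open>P\<close> of positive roots. The space it spans is the
  subspace \<open>span P\<close> of the ambient Euclidean space, and hyperplanes and regions live in it.
\<close>

definition roots :: "'a::euclidean_space set \<Rightarrow> 'a set" where
  "roots P = P \<union> uminus ` P"

definition root_hyperplane :: "'a::euclidean_space set \<Rightarrow> 'a \<Rightarrow> int \<Rightarrow> 'a set" where
  "root_hyperplane P \<alpha> k = {x \<in> span P. \<alpha> \<bullet> x = of_int k}"

text \<open>
  Here \<open>\<alpha>\<close> ranges over all roots, negative ones included, so the hyperplanes
  \<open>\<alpha> \<bullet> x = - m\<close> with \<open>\<alpha>\<close> positive occur as well. They do not meet the dominant chamber
  and hence affect neither the positive regions nor their heights.
\<close>

definition shi_arrangement :: "nat \<Rightarrow> 'a::euclidean_space set \<Rightarrow> 'a set set" where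
  "shi_arrangement m P =
     {root_hyperplane P \<alpha> k | \<alpha> k. \<alpha> \<in> roots P \<and> - int m < k \<and> k \<le> int m}"

definition dominant_chamber :: "'a::euclidean_space set \<Rightarrow> 'a set" where
  "dominant_chamber P = {x \<in> span P. \<forall>\<alpha>\<in>P. 0 < \<alpha> \<bullet> x}"

definition shi_regions :: "nat \<Rightarrow> 'a::euclidean_space set \<Rightarrow> 'a set set" where
  "shi_regions m P = components (span P - \<Union>(shi_arrangement m P))"

definition positive_regions :: "nat \<Rightarrow> 'a::euclidean_space set \<Rightarrow> 'a set set" where
  "positive_regions m P = {R \<in> shi_regions m P. R \<subseteq> dominant_chamber P}"

definition fundamental_region :: "'a::euclidean_space set \<Rightarrow> 'a set" where
  "fundamental_region P = {x \<in> span P. \<forall>\<alpha>\<in>P. 0 < \<alpha> \<bullet> x \<and> \<alpha> \<bullet> x < 1}"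

text \<open>
  \<open>A\<close> and \<open>B\<close> lie strictly on opposite sides of the hyperplane \<open>H\<close> of \<open>V\<close>; replacing
  \<open>(a, c)\<close> by \<open>(- a, - c)\<close> shows that the relation is symmetric in \<open>A\<close> and \<open>B\<close>.
\<close>

definition separates :: "'a::euclidean_space set \<Rightarrow> 'a set \<Rightarrow> 'a set \<Rightarrow> 'a set \<Rightarrow> bool" where
  "separates V H A B \<longleftrightarrow>
     (\<exists>a c. H = {x \<in> V. a \<bullet> x = c} \<and> (\<forall>x\<in>A. a \<bullet> x < c) \<and> (\<forall>x\<in>B. c < a \<bullet> x))"

definition height :: "nat \<Rightarrow> 'a::euclidean_space set \<Rightarrow> 'a set \<Rightarrow> nat" where
  "height m P R =
     card {H \<in> shi_arrangement m P. separates (span P) H R (fundamental_region P)}"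

text \<open>
  The subtraction does not truncate on positive regions: only hyperplanes \<open>\<alpha> \<bullet> x = k\<close> with
  \<open>\<alpha> \<in> P\<close> and \<open>1 \<le> k \<le> m\<close> can separate two subsets of the dominant chamber.
\<close>

definition coheight :: "nat \<Rightarrow> 'a::euclidean_space set \<Rightarrow> 'a set \<Rightarrow> nat" where
  "coheight m P R = m * card P - height m P R"

definition Cat_Shi :: "nat \<Rightarrow> 'a::euclidean_space set \<Rightarrow> int poly" where
  "Cat_Shi m P = (\<Sum>R\<in>positive_regions m P. monom 1 (coheight m P R))"

text \<open>
  Coordinates are indexed by a finite linearly ordered type \<open>'n\<close>, which plays the role of
  \<open>{1, \<dots>, n}\<close> with \<open>n = CARD('n)\<close>.
\<close>

definition pos_roots_A :: "(real ^ 'n::{finite,linorder}) set" where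
  "pos_roots_A = {axis i 1 - axis j 1 | i j. i < j}"

definition pos_roots_B :: "(real ^ 'n::{finite,linorder}) set" where
  "pos_roots_B =
     {axis i 1 - axis j 1 | i j. i < j} \<union> {axis i 1 + axis j 1 | i j. i < j} \<union>
     {axis i 1 | i. True}"

text \<open>An integer partition is the list of its nonzero parts in weakly decreasing order.\<close>

definition is_partition :: "nat list \<Rightarrow> bool" where
  "is_partition p \<longleftrightarrow> sorted_wrt (\<ge>) p \<and> 0 \<notin> set p"

definition fits_inside :: "nat list \<Rightarrow> nat list \<Rightarrow> bool" where
  "fits_inside p \<mu> \<longleftrightarrow> length p \<le> length \<mu> \<and> (\<forall>i<length p. p ! i \<le> \<mu> ! i)"

definition staircase :: "nat \<Rightarrow> nat \<Rightarrow> nat list" where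
  "staircase m n = map (\<lambda>i. (n - i) * m) [1..<n]"

definition catalan_partitions :: "nat \<Rightarrow> nat \<Rightarrow> nat list set" where
  "catalan_partitions m n = {p. is_partition p \<and> fits_inside p (staircase m n)}"

definition area_A :: "nat \<Rightarrow> nat \<Rightarrow> nat list \<Rightarrow> nat" where
  "area_A m n p = m * (n choose 2) - sum_list p"

definition Cat_A :: "nat \<Rightarrow> nat \<Rightarrow> int poly" where
  "Cat_A m n = (\<Sum>p\<in>catalan_partitions m n. monom 1 (area_A m n p))"

datatype step = North | East

definition path_vertex :: "step list \<Rightarrow> nat \<Rightarrow> nat \<times> nat" where
  "path_vertex w i = (count_list (take i w) East, count_list (take i w) North)"

definition catalan_paths_B :: "nat \<Rightarrow> step list set" where
  "catalan_paths_B n =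
     {w. length w = 2 * n \<and> (\<forall>i\<le>2 * n. fst (path_vertex w i) \<le> snd (path_vertex w i))}"

definition path_curve :: "step list \<Rightarrow> (real \<times> real) set" where
  "path_curve w =
     (\<Union>i<length w. closed_segment (map_prod real real (path_vertex w i))
                                   (map_prod real real (path_vertex w (Suc i))))"

text \<open>
  The region bounded by the path, the diagonal \<open>y = x\<close> and the anti-diagonal
  \<open>x + y = 2 n\<close>: the points between the two lines with a point of the path weakly to their
  left at the same height.
\<close>

definition path_region :: "nat \<Rightarrow> step list \<Rightarrow> (real \<times> real) set" where
  "path_region n w =
     {(x, y). x \<le> y \<and> x + y \<le> 2 * real n \<and> (\<exists>x'\<le>x. (x', y) \<in> path_curve w)}"

definition unit_square :: "nat \<Rightarrow> nat \<Rightarrow> (real \<times> real) set" where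
  "unit_square a b = {real a..real a + 1} \<times> {real b..real b + 1}"

text \<open>
  Counted are the squares whose part below the anti-diagonal lies in the region. The condition
  \<open>a + b < 2 * n\<close> says that this part is the whole square or its lower left half. Squares cut
  by \<open>y = x\<close> contain points with \<open>y < x\<close> below the anti-diagonal and are thus excluded.
\<close>

definition area_B :: "nat \<Rightarrow> step list \<Rightarrow> nat" where
  "area_B n w =
     card {(a, b). a + b < 2 * n \<and>
                   unit_square a b \<inter> {(x, y). x + y \<le> 2 * real n} \<subseteq> path_region n w}"

definition Cat_B :: "nat \<Rightarrow> int poly" where
  "Cat_B n = (\<Sum>w\<in>catalan_paths_B n. monom 1 (area_B n w))"

end

theory Submission
  imports Defs
begin

text \<open>
  A positive region is determined by the set of pairs \<open>(\<alpha>, k)\<close> with \<open>\<alpha> \<in> P\<close>, \<open>1 \<le> k \<le> m\<close> and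
  \<open>k < \<alpha> \<bullet> x\<close>, and its height is the size of this set. List the coordinates of \<open>x\<close> increasingly as
  \<open>y 0 < y 1 < \<dots>\<close> and group these pairs by the larger coordinate \<open>y k\<close> occurring in \<open>\<alpha>\<close>: the number
  of pairs in row \<open>k\<close> is the number of values \<open>y l + t\<close> with \<open>l < k\<close> and \<open>1 \<le> t \<le> m\<close> below \<open>y k\<close>,
  and in type \<open>B\<close> with \<open>m = 1\<close> the number of values among \<open>1\<close> and \<open>1 \<plusminus> y l\<close> below \<open>y k\<close>.
  The relative order of these values depends only on the previous rows, so the vector of row counts
  determines the region; conversely, every vector satisfying the obvious necessary conditions is
  realised by choosing \<open>y 0, y 1, \<dots>\<close> one after the other.

  In type \<open>A\<close> the nonzero row counts are the parts of the partition. In type \<open>B\<close> they are the numbers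
  \<open>2 n - p\<close>, where \<open>p\<close> runs through the positions of the east steps of the path.
\<close>

subsection \<open>Positive regions and crossed walls\<close>

text \<open>No membership in \<open>span P\<close> is demanded, so that points can later be given by
  arbitrary coordinates; in type A the span is only the hyperplane of coordinate sum 0.\<close>

definition off_walls :: "nat \<Rightarrow> 'a::euclidean_space set \<Rightarrow> 'a set" where
  "off_walls m P = {x. \<forall>\<alpha>\<in>P. 0 < \<alpha> \<bullet> x \<and> (\<forall>k\<in>{1..m}. \<alpha> \<bullet> x \<noteq> real k)}"

definition crossed_walls :: "nat \<Rightarrow> 'a::euclidean_space set \<Rightarrow> 'a \<Rightarrow> ('a \<times> nat) set" where
  "crossed_walls m P x = {(\<alpha>, k). \<alpha> \<in> P \<and> k \<in> {1..m} \<and> real k < \<alpha> \<bullet> x}"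

text \<open>On a dominant point the sign of the constant is forced: \<open>k\<close> is positive for
  a positive root, and for a negative root \<open>\<beta>\<close> one passes to
  \<open>- \<beta>\<close> and \<open>- k\<close>. What remains are the pairs with a positive root
  and \<open>1 \<le> k \<le> m\<close>.\<close>

lemma mem_off_walls_iff:
  assumes "x \<in> dominant_chamber P"
  shows "x \<in> off_walls m P \<longleftrightarrow> x \<notin> \<Union>(shi_arrangement m P)"
proof -
  have sp: "x \<in> span P" and pos: "\<And>\<alpha>. \<alpha> \<in> P \<Longrightarrow> 0 < \<alpha> \<bullet> x"
    using assms by (auto simp: dominant_chamber_def)
  have "x \<in> \<Union>(shi_arrangement m P) \<longleftrightarrow> (\<exists>\<alpha>\<in>P. \<exists>k\<in>{1..m}. \<alpha> \<bullet> x = real k)"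
  proof
    assume "x \<in> \<Union>(shi_arrangement m P)"
    then obtain \<beta> k where b: "\<beta> \<in> roots P" "- int m < k" "k \<le> int m" "\<beta> \<bullet> x = of_int k"
      by (auto simp: shi_arrangement_def root_hyperplane_def)
    show "\<exists>\<alpha>\<in>P. \<exists>k\<in>{1..m}. \<alpha> \<bullet> x = real k"
    proof (cases "\<beta> \<in> P")
      case True
      then have "0 < k" using pos[OF True] b by simp
      then show ?thesis using True b
        by (intro bexI[of _ \<beta>] bexI[of _ "nat k"]) auto
    next
      case False
      then obtain \<alpha> where a: "\<alpha> \<in> P" "\<beta> = - \<alpha>" using b by (auto simp: roots_def)
      then have e: "\<alpha> \<bullet> x = of_int (- k)" using b by simp
      then have "0 < - k" using pos[OF a(1)] by simp
      then show ?thesis using a b e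
        by (intro bexI[of _ \<alpha>] bexI[of _ "nat (- k)"]) auto
    qed
  next
    assume "\<exists>\<alpha>\<in>P. \<exists>k\<in>{1..m}. \<alpha> \<bullet> x = real k"
    then obtain \<alpha> k where ak: "\<alpha> \<in> P" "k \<in> {1..m}" "\<alpha> \<bullet> x = of_int (int k)" by auto
    then have "x \<in> root_hyperplane P \<alpha> (int k)" using sp by (simp add: root_hyperplane_def)
    moreover have "\<alpha> \<in> roots P \<and> - int m < int k \<and> int k \<le> int m"
      using ak by (auto simp: roots_def)
    then have "root_hyperplane P \<alpha> (int k) \<in> shi_arrangement m P"
      unfolding shi_arrangement_def by blast
    ultimately show "x \<in> \<Union>(shi_arrangement m P)" by blast
  qed
  then show ?thesis using pos by (auto simp: off_walls_def)
qed

lemma connected_same_side: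
  fixes a :: "'a::euclidean_space"
  assumes "connected R" "\<And>z. z \<in> R \<Longrightarrow> a \<bullet> z \<noteq> c" "x \<in> R" "y \<in> R" "c < a \<bullet> x"
  shows "c < a \<bullet> y"
proof (rule ccontr)
  assume "\<not> c < a \<bullet> y"
  then obtain z where "z \<in> R" "a \<bullet> z = c"
    using connected_ivt_hyperplane[OF assms(1,4,3), of a c] assms(5) by auto
  then show False using assms(2) by blast
qed

lemma dominant_off_walls: "span P \<inter> off_walls m P \<subseteq> dominant_chamber P"
  by (auto simp: off_walls_def dominant_chamber_def)

text \<open>Points off the walls with the same crossed walls satisfy the same strict linear
  inequalities, so they form a convex, hence connected, set and share a region. Conversely, a
  connected set that avoids the hyperplanes cannot change sides.\<close>

lemma positive_regions_eq:
  fixes P :: "'a::euclidean_space set"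
  assumes "1 \<le> m"
  shows "positive_regions m P =
    (\<lambda>x. {y \<in> span P \<inter> off_walls m P. crossed_walls m P y = crossed_walls m P x}) `
      (span P \<inter> off_walls m P)"
proof -
  define U where "U = span P - \<Union>(shi_arrangement m P)"
  define C where "C x = {y \<in> span P \<inter> off_walls m P. crossed_walls m P y = crossed_walls m P x}" for x
  have sub: "span P \<inter> off_walls m P \<subseteq> U"
    using mem_off_walls_iff dominant_off_walls unfolding U_def by blast
  have conv: "convex (C x)" for x
  proof (rule convexI)
    fix y z and u v :: real
    assume yz: "y \<in> C x" "z \<in> C x" and uv: "0 \<le> u" "0 \<le> v" "u + v = 1"
    let ?w = "u *\<^sub>R y + v *\<^sub>R z"
    have up: "\<alpha> \<bullet> ?w > c" if "\<alpha> \<bullet> y > c" "\<alpha> \<bullet> z > c" for \<alpha> c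
      using convex_halfspace_gt[of c \<alpha>] that uv unfolding convex_def by blast
    have dn: "\<alpha> \<bullet> ?w < c" if "\<alpha> \<bullet> y < c" "\<alpha> \<bullet> z < c" for \<alpha> c
      using convex_halfspace_lt[of \<alpha> c] that uv unfolding convex_def by blast
    have s: "?w \<in> span P" using yz by (auto simp: C_def intro: span_add span_scale)
    have side: "real k < \<alpha> \<bullet> y \<and> real k < \<alpha> \<bullet> z \<and> real k < \<alpha> \<bullet> x \<or>
      \<alpha> \<bullet> y < real k \<and> \<alpha> \<bullet> z < real k \<and> \<not> real k < \<alpha> \<bullet> x"
      if "\<alpha> \<in> P" "k \<in> {1..m}" for \<alpha> k
    proof -
      have "(\<alpha>, k) \<in> crossed_walls m P y \<longleftrightarrow> (\<alpha>, k) \<in> crossed_walls m P x"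
        "(\<alpha>, k) \<in> crossed_walls m P z \<longleftrightarrow> (\<alpha>, k) \<in> crossed_walls m P x"
        using yz by (auto simp: C_def)
      moreover have "\<alpha> \<bullet> y \<noteq> real k" "\<alpha> \<bullet> z \<noteq> real k"
        using yz that by (auto simp: C_def off_walls_def)
      ultimately show ?thesis using that by (auto simp: crossed_walls_def)
    qed
    have "?w \<in> off_walls m P"
      unfolding off_walls_def
    proof (clarsimp, intro conjI ballI)
      fix \<alpha> assume a: "\<alpha> \<in> P"
      show "0 < \<alpha> \<bullet> ?w" using a yz by (intro up) (auto simp: C_def off_walls_def)
      fix k assume k: "k \<in> {Suc 0..m}"
      then show "\<alpha> \<bullet> ?w \<noteq> real k" using side[OF a, of k] up[of "real k" \<alpha>] dn[of \<alpha> "real k"] by auto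
    qed
    moreover have "real k < \<alpha> \<bullet> ?w \<longleftrightarrow> real k < \<alpha> \<bullet> x" if "\<alpha> \<in> P" "k \<in> {1..m}" for \<alpha> k
      using side[OF that] up[of "real k" \<alpha>] dn[of \<alpha> "real k"] by auto
    then have "crossed_walls m P ?w = crossed_walls m P x"
      by (auto simp: crossed_walls_def)
    ultimately show "?w \<in> C x" using s by (simp add: C_def)
  qed
  \<comment> \<open>Maximality among the connected subsets of \<open>U\<close> through
    \<open>x\<close> is the property that a given region and the component of a given point have in
    common, so both directions below follow from this.\<close>
  have main: "R = C x" if R: "connected R" "R \<subseteq> U" "x \<in> R" "x \<in> off_walls m P"
    and mx: "\<And>T. connected T \<Longrightarrow> T \<subseteq> U \<Longrightarrow> x \<in> T \<Longrightarrow> T \<subseteq> R" for R x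
  proof
    have xs: "x \<in> span P" using R by (auto simp: U_def)
    show "C x \<subseteq> R"
      by (rule mx[OF convex_connected[OF conv]]) (use sub R xs in \<open>auto simp: C_def\<close>)
    \<comment> \<open>The value \<open>k = 0\<close> is included: \<open>1 \<le> m\<close> puts the
      walls of the dominant chamber into the arrangement, which keeps \<open>R\<close> inside the
      chamber.\<close>
    have H: "root_hyperplane P \<alpha> (int k) \<in> shi_arrangement m P" if "\<alpha> \<in> P" "k \<in> {0..m}" for \<alpha> k
      using that assms unfolding shi_arrangement_def roots_def by force
    have off: "\<alpha> \<bullet> z \<noteq> real k" if "z \<in> R" "\<alpha> \<in> P" "k \<in> {0..m}" for z \<alpha> k
      using H[OF that(2,3)] that R(2) by (auto simp: U_def root_hyperplane_def)
    show "R \<subseteq> C x"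
    proof
      fix y assume y: "y \<in> R"
      have "(real k < \<alpha> \<bullet> x) = (real k < \<alpha> \<bullet> y)" if "\<alpha> \<in> P" "k \<in> {0..m}" for \<alpha> k
        using connected_same_side[OF R(1) off] that y R(3) by blast
      moreover from this[of _ 0] have "0 < \<alpha> \<bullet> y" if "\<alpha> \<in> P" for \<alpha>
        using R(4) that by (auto simp: off_walls_def)
      ultimately show "y \<in> C x"
        using y R(2) off[OF y] by (auto simp: C_def U_def off_walls_def crossed_walls_def)
    qed
  qed
  have "R \<in> positive_regions m P \<longleftrightarrow> R \<in> C ` (span P \<inter> off_walls m P)" for R
  proof
    assume R: "R \<in> positive_regions m P"
    then have c: "R \<in> components U" and d: "R \<subseteq> dominant_chamber P"
      by (auto simp: positive_regions_def shi_regions_def U_def)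
    obtain x where x: "x \<in> R" using in_components_nonempty[OF c] by blast
    have RU: "R \<subseteq> U" using in_components_subset[OF c] .
    have xo: "x \<in> off_walls m P"
      using mem_off_walls_iff[of x P m] d x RU by (auto simp: U_def)
    have "R = C x"
    proof (rule main[OF in_components_connected[OF c] RU x xo])
      fix T assume "connected T" "T \<subseteq> U" "x \<in> T"
      then show "T \<subseteq> R" using components_maximal[OF c] x by blast
    qed
    then show "R \<in> C ` (span P \<inter> off_walls m P)" using x xo d by (auto simp: dominant_chamber_def)
  next
    assume "R \<in> C ` (span P \<inter> off_walls m P)"
    then obtain x where x: "x \<in> span P \<inter> off_walls m P" "R = C x" by auto
    have "x \<in> U" using sub x by blast
    then have "connected_component_set U x = C x"
      by (intro main) (use x in \<open>auto simp: connected_component_subset connected_component_maximal\<close>)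
    moreover have "C x \<subseteq> dominant_chamber P" using dominant_off_walls unfolding C_def by blast
    ultimately show "R \<in> positive_regions m P"
      using x \<open>x \<in> U\<close> unfolding positive_regions_def shi_regions_def U_def[symmetric] components_def
      by auto
  qed
  then show ?thesis unfolding C_def by blast
qed

section \<open>Heights as numbers of crossed walls\<close>

text \<open>The difference \<open>v\<close> of the two sides is orthogonal to every point of the
  common hyperplane. Among these is \<open>p\<close>, a nonzero multiple of \<open>\<alpha>\<close>,
  so \<open>v\<close> is orthogonal to \<open>\<alpha>\<close>; then \<open>p + v\<close> lies in
  the hyperplane too, and \<open>v \<bullet> v = 0\<close>.\<close>

lemma root_hyperplane_eqD:
  assumes "root_hyperplane P \<alpha> k = root_hyperplane P \<beta> l" "\<alpha> \<in> P" "\<beta> \<in> P" "\<alpha> \<noteq> 0" "k \<noteq> 0"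
  shows "of_int l *\<^sub>R \<alpha> = of_int k *\<^sub>R \<beta>"
proof -
  define v where "v = of_int l *\<^sub>R \<alpha> - of_int k *\<^sub>R \<beta>"
  define p where "p = (of_int k / (\<alpha> \<bullet> \<alpha>)) *\<^sub>R \<alpha>"
  have sp: "v \<in> span P" "p \<in> span P" using assms
    by (auto simp: v_def p_def intro: span_diff span_scale span_base)
  have z: "v \<bullet> x = 0" if "x \<in> root_hyperplane P \<alpha> k" for x
  proof -
    have "\<alpha> \<bullet> x = of_int k" "\<beta> \<bullet> x = of_int l"
      using that assms(1) by (auto simp: root_hyperplane_def)
    then show ?thesis by (simp add: v_def inner_diff_left)
  qed
  have p: "p \<in> root_hyperplane P \<alpha> k" using sp(2) assms(4) by (simp add: p_def root_hyperplane_def)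
  then have "v \<bullet> p = 0" using z by blast
  then have va: "\<alpha> \<bullet> v = 0" using assms by (simp add: p_def inner_commute)
  then have "p + v \<in> root_hyperplane P \<alpha> k"
    using p sp by (simp add: root_hyperplane_def inner_add_right span_add)
  then have "v \<bullet> (p + v) = 0" using z by blast
  then have "v \<bullet> v = 0" using \<open>v \<bullet> p = 0\<close> by (simp add: inner_add_right)
  then show ?thesis by (simp add: v_def)
qed

text \<open>A dominant point is scaled down by a bound for all its root values. Nonemptiness keeps
  \<open>separates\<close> from being vacuous on the side of the fundamental region.\<close>

lemma fundamental_region_nonempty:
  assumes "finite P" "x \<in> dominant_chamber P"
  shows "fundamental_region P \<noteq> {}"
proof -
  define s where "s = 1 + (\<Sum>\<alpha>\<in>P. \<alpha> \<bullet> x)"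
  have pos: "0 < \<alpha> \<bullet> x" if "\<alpha> \<in> P" for \<alpha> using assms that by (auto simp: dominant_chamber_def)
  have le: "\<alpha> \<bullet> x < s" if "\<alpha> \<in> P" for \<alpha>
    using member_le_sum[of \<alpha> P "\<lambda>\<alpha>. \<alpha> \<bullet> x"] that pos assms(1) by (force simp: s_def)
  have "0 \<le> (\<Sum>\<alpha>\<in>P. \<alpha> \<bullet> x)" by (rule sum_nonneg) (use pos in \<open>simp add: less_imp_le\<close>)
  then have s: "s > 0" by (simp add: s_def)
  have "(1 / s) *\<^sub>R x \<in> fundamental_region P"
    using assms(2) pos le s unfolding fundamental_region_def dominant_chamber_def
    by (auto intro: span_scale)
  then show ?thesis by blast
qed

text \<open>A separating hyperplane meets the segment from \<open>x\<close> to a fundamental point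
  in a dominant point, so its constant for a positive root is at least 1. The fundamental point lies
  below it, hence \<open>x\<close> lies above it. Distinct pairs give distinct hyperplanes because
  no root is a proper positive multiple of another.\<close>

lemma height_eq_card_crossed_walls:
  assumes fin: "finite P" and np: "\<And>\<alpha> \<beta> c. \<alpha> \<in> P \<Longrightarrow> \<beta> \<in> P \<Longrightarrow> 0 < c \<Longrightarrow> \<alpha> = c *\<^sub>R \<beta> \<Longrightarrow> c = 1"
    and R: "R = {y \<in> span P \<inter> off_walls m P. crossed_walls m P y = crossed_walls m P x}"
    and x: "x \<in> span P \<inter> off_walls m P"
  shows "height m P R = card (crossed_walls m P x)"
proof -
  let ?h = "\<lambda>(\<alpha>, k). root_hyperplane P \<alpha> (int k)"
  \<comment> \<open>The zero vector equals twice itself, which \<open>np\<close> forbids.\<close>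
  have nz: "\<alpha> \<noteq> 0" if "\<alpha> \<in> P" for \<alpha> using np[OF that that, of 2] by auto
  have xR: "x \<in> R" using x R by blast
  have xd: "x \<in> dominant_chamber P" using x dominant_off_walls by blast
  have "{H \<in> shi_arrangement m P. separates (span P) H R (fundamental_region P)} =
      ?h ` crossed_walls m P x" (is "?L = ?R")
  proof
    show "?L \<subseteq> ?R"
    proof clarify
      fix H assume H: "H \<in> shi_arrangement m P" and sep: "separates (span P) H R (fundamental_region P)"
      obtain a c where ac: "H = {x \<in> span P. a \<bullet> x = c}" "\<forall>x\<in>R. a \<bullet> x < c"
        "\<forall>x\<in>fundamental_region P. c < a \<bullet> x"
        using sep by (auto simp: separates_def)
      obtain y where y: "y \<in> fundamental_region P" using fundamental_region_nonempty[OF fin xd] by blast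
      have yd: "y \<in> dominant_chamber P" using y by (auto simp: fundamental_region_def dominant_chamber_def)
      \<comment> \<open>The functional \<open>a\<close> provided by \<open>separates\<close> need
        not be a root. Only the crossing point \<open>z\<close> is kept, because it also satisfies
        the root equation of \<open>H\<close>.\<close>
      have "\<exists>z\<in>closed_segment x y. a \<bullet> z = c"
        by (rule connected_ivt_hyperplane[of _ x y]) (use ac xR y in \<open>auto simp: less_imp_le\<close>)
      then obtain z where z: "z \<in> closed_segment x y" "a \<bullet> z = c" by blast
      then obtain u where u: "0 \<le> u" "u \<le> 1" "z = (1 - u) *\<^sub>R x + u *\<^sub>R y"
        by (auto simp: closed_segment_def)
      have zs: "z \<in> span P" unfolding u(3)
        using xd yd by (auto simp: dominant_chamber_def intro!: span_add span_scale)
      then have zH: "z \<in> H" using ac z by blast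
      obtain \<beta> k where b: "\<beta> \<in> roots P" "- int m < k" "k \<le> int m" "H = root_hyperplane P \<beta> k"
        using H by (auto simp: shi_arrangement_def)
      obtain \<alpha> j where a: "\<alpha> \<in> P" "- int m \<le> j" "j \<le> int m" "H = root_hyperplane P \<alpha> j"
      proof (cases "\<beta> \<in> P")
        case True then show ?thesis using b that[of \<beta> k] by auto
      next
        case False
        then obtain \<alpha> where "\<alpha> \<in> P" "\<beta> = - \<alpha>" using b by (auto simp: roots_def)
        moreover have "root_hyperplane P (- \<alpha>) k = root_hyperplane P \<alpha> (- k)"
          by (auto simp: root_hyperplane_def)
        ultimately show ?thesis using b that[of \<alpha> "- k"] by auto
      qed
      have az: "\<alpha> \<bullet> z = of_int j" using zH a by (simp add: root_hyperplane_def)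
      have "convex (dominant_chamber P)"
      proof -
        have "dominant_chamber P = span P \<inter> (\<Inter>\<alpha>\<in>P. {x. \<alpha> \<bullet> x > 0})"
          by (auto simp: dominant_chamber_def)
        then show ?thesis
          by (simp add: convex_Int convex_INT convex_halfspace_gt subspace_imp_convex)
      qed
      then have "z \<in> dominant_chamber P"
        using z xd yd closed_segment_subset by blast
      then have "0 < j" using az a by (auto simp: dominant_chamber_def)
      have "real (nat j) < \<alpha> \<bullet> x"
      proof (rule ccontr)
        assume "\<not> ?thesis"
        moreover have "nat j \<in> {1..m}" using a \<open>0 < j\<close> by auto
        then have "\<alpha> \<bullet> x \<noteq> real (nat j)" using x a(1) unfolding off_walls_def by blast
        ultimately have "\<alpha> \<bullet> x < of_int j" using \<open>0 < j\<close> by simp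
        moreover have "\<alpha> \<bullet> y < of_int j" using y a \<open>0 < j\<close>
          by (force simp: fundamental_region_def)
        ultimately have "\<alpha> \<bullet> z < of_int j"
          using z convex_halfspace_lt[of \<alpha> "of_int j"] closed_segment_subset[of x "{x. \<alpha> \<bullet> x < of_int j}" y]
          by blast
        then show False using az by simp
      qed
      then have "(\<alpha>, nat j) \<in> crossed_walls m P x"
        using a \<open>0 < j\<close> by (auto simp: crossed_walls_def)
      moreover have "H = ?h (\<alpha>, nat j)" using a \<open>0 < j\<close> by simp
      ultimately show "H \<in> ?R" by blast
    qed
    show "?R \<subseteq> ?L"
    proof clarify
      fix \<alpha> k assume ak: "(\<alpha>, k) \<in> crossed_walls m P x"
      have a: "\<alpha> \<in> P" "1 \<le> k" "k \<le> m" using ak by (auto simp: crossed_walls_def)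
      \<comment> \<open>The signs are reversed because \<open>separates\<close> wants
        \<open>R\<close> on the smaller side, while \<open>R\<close> lies above the walls it has
        crossed.\<close>
      have "root_hyperplane P \<alpha> (int k) = {x \<in> span P. (- \<alpha>) \<bullet> x = - real k}"
        by (auto simp: root_hyperplane_def)
      moreover have "\<forall>y\<in>R. (- \<alpha>) \<bullet> y < - real k"
      proof
        fix y assume "y \<in> R"
        then have "(\<alpha>, k) \<in> crossed_walls m P y" using ak R by blast
        then show "(- \<alpha>) \<bullet> y < - real k" by (simp add: crossed_walls_def)
      qed
      moreover have "\<forall>y\<in>fundamental_region P. - real k < (- \<alpha>) \<bullet> y"
        using a by (force simp: fundamental_region_def)
      ultimately have "separates (span P) (root_hyperplane P \<alpha> (int k)) R (fundamental_region P)"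
        unfolding separates_def by blast
      moreover have "root_hyperplane P \<alpha> (int k) \<in> shi_arrangement m P"
        using a unfolding shi_arrangement_def roots_def by force
      ultimately show "root_hyperplane P \<alpha> (int k) \<in> shi_arrangement m P \<and>
        separates (span P) (root_hyperplane P \<alpha> (int k)) R (fundamental_region P)" by blast
    qed
  qed
  moreover have "inj_on ?h (crossed_walls m P x)"
  proof (rule inj_onI, clarify)
    fix \<alpha> k \<beta> l
    assume *: "(\<alpha>, k) \<in> crossed_walls m P x" "(\<beta>, l) \<in> crossed_walls m P x"
      "root_hyperplane P \<alpha> (int k) = root_hyperplane P \<beta> (int l)"
    then have ab: "\<alpha> \<in> P" "\<beta> \<in> P" "1 \<le> k" "1 \<le> l" by (auto simp: crossed_walls_def)
    have e: "real l *\<^sub>R \<alpha> = real k *\<^sub>R \<beta>"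
      using root_hyperplane_eqD[OF *(3)] ab nz by simp
    have "\<alpha> = inverse (real l) *\<^sub>R (real l *\<^sub>R \<alpha>)" using ab by simp
    also have "\<dots> = (real k / real l) *\<^sub>R \<beta>" unfolding e by (simp add: field_simps)
    finally have "\<alpha> = (real k / real l) *\<^sub>R \<beta>" .
    moreover from this have "real k / real l = 1"
      by (rule np[OF ab(1,2), rotated]) (use ab in simp)
    ultimately show "\<alpha> = \<beta> \<and> k = l" by simp
  qed
  ultimately show ?thesis by (simp add: height_def card_image)
qed

section \<open>The generating function as a sum over an invariant of regions\<close>

lemma ex_span_same_inner:
  fixes x :: "'a::euclidean_space"
  obtains x' where "x' \<in> span P" "\<And>\<alpha>. \<alpha> \<in> P \<Longrightarrow> \<alpha> \<bullet> x' = \<alpha> \<bullet> x"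
proof -
  obtain y z where yz: "y \<in> span P" "\<And>w. w \<in> span P \<Longrightarrow> orthogonal z w" "x = y + z"
    using orthogonal_subspace_decomp_exists[of P x] by metis
  have "\<alpha> \<bullet> y = \<alpha> \<bullet> x" if "\<alpha> \<in> P" for \<alpha>
    using yz(2)[OF span_base[OF that]] yz(3)
    by (simp add: inner_add_right orthogonal_def inner_commute)
  then show thesis using that yz by blast
qed

text \<open>
  The points need not lie in \<open>span P\<close>: projecting orthogonally to \<open>span P\<close> does not change the
  inner products with the roots.
\<close>

lemma Cat_Shi_eq_sum:
  fixes f :: "'a::euclidean_space \<Rightarrow> 'b" and \<rho> :: "'c \<Rightarrow> 'a"
  assumes m: "1 \<le> m" and fin: "finite I" and P: "P = \<rho> ` I" and inj: "inj_on \<rho> I"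
    and np: "\<And>\<alpha> \<beta> c. \<alpha> \<in> P \<Longrightarrow> \<beta> \<in> P \<Longrightarrow> 0 < c \<Longrightarrow> \<alpha> = c *\<^sub>R \<beta> \<Longrightarrow> c = 1"
    and f: "\<And>x y. x \<in> off_walls m P \<Longrightarrow> y \<in> off_walls m P \<Longrightarrow>
      f x = f y \<longleftrightarrow> (\<forall>i\<in>I. \<forall>k\<in>{1..m}. real k < \<rho> i \<bullet> x \<longleftrightarrow> real k < \<rho> i \<bullet> y)"
    and g: "\<And>x. x \<in> off_walls m P \<Longrightarrow>
      g (f x) = card {(i, k). i \<in> I \<and> k \<in> {1..m} \<and> real k < \<rho> i \<bullet> x}"
  shows "Cat_Shi m P = (\<Sum>v\<in>f ` off_walls m P. monom 1 (m * card I - g v))"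
proof -
  define D where "D = span P \<inter> off_walls m P"
  define C where "C x = {y \<in> D. crossed_walls m P y = crossed_walls m P x}" for x
  have finP: "finite P" using fin P by simp
  have fK: "f x = f y \<longleftrightarrow> crossed_walls m P x = crossed_walls m P y"
    if "x \<in> off_walls m P" "y \<in> off_walls m P" for x y
  proof
    assume "f x = f y"
    then show "crossed_walls m P x = crossed_walls m P y"
      unfolding f[OF that] by (auto simp: crossed_walls_def P)
  next
    assume e: "crossed_walls m P x = crossed_walls m P y"
    show "f x = f y"
      unfolding f[OF that]
    proof (intro ballI)
      fix i k assume "i \<in> I" "k \<in> {1..m}"
      moreover have "(\<rho> i, k) \<in> crossed_walls m P x \<longleftrightarrow> (\<rho> i, k) \<in> crossed_walls m P y"
        using e by simp
      ultimately show "real k < \<rho> i \<bullet> x \<longleftrightarrow> real k < \<rho> i \<bullet> y"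
        by (auto simp: crossed_walls_def P)
    qed
  qed
  have gK: "g (f x) = card (crossed_walls m P x)" if "x \<in> off_walls m P" for x
  proof -
    have "crossed_walls m P x = map_prod \<rho> id ` {(i, k). i \<in> I \<and> k \<in> {1..m} \<and> real k < \<rho> i \<bullet> x}"
      by (force simp: crossed_walls_def P)
    moreover have "inj_on (map_prod \<rho> id) {(i, k). i \<in> I \<and> k \<in> {1..m} \<and> real k < \<rho> i \<bullet> x}"
      by (rule inj_on_subset[OF map_prod_inj_on[OF inj inj_on_id[of UNIV]]]) auto
    ultimately show ?thesis using g[OF that] by (simp add: card_image)
  qed
  have fD: "f ` D = f ` off_walls m P"
  proof
    show "f ` off_walls m P \<subseteq> f ` D"
    proof clarify
      fix x assume x: "x \<in> off_walls m P"
      obtain x' where x': "x' \<in> span P" "\<And>\<alpha>. \<alpha> \<in> P \<Longrightarrow> \<alpha> \<bullet> x' = \<alpha> \<bullet> x"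
        using ex_span_same_inner by metis
      then have xo: "x' \<in> off_walls m P" using x by (auto simp: off_walls_def)
      moreover have "f x = f x'" unfolding fK[OF x xo] using x'(2) by (auto simp: crossed_walls_def)
      ultimately show "f x \<in> f ` D" using x' by (auto simp: D_def)
    qed
  qed (auto simp: D_def)
  have CD: "C x = C y \<longleftrightarrow> f x = f y" if "x \<in> D" "y \<in> D" for x y
    using that fK[of x y] by (auto simp: C_def D_def)
  \<comment> \<open>\<open>F\<close> reads the invariant of a region off a chosen point; by
    \<open>CD\<close> the choice does not matter and distinct regions get distinct values.\<close>
  define F where "F R = f (SOME x. x \<in> D \<and> C x = R)" for R
  have F: "F (C x) = f x" if "x \<in> D" for x
    unfolding F_def by (rule someI2[of _ x]) (use that CD in auto)
  have "Cat_Shi m P = (\<Sum>R\<in>C ` D. monom 1 (coheight m P R))"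
    unfolding Cat_Shi_def positive_regions_eq[OF m] C_def D_def ..
  also have "\<dots> = (\<Sum>R\<in>C ` D. monom 1 (m * card I - g (F R)))"
  proof (rule sum.cong[OF refl])
    fix R assume "R \<in> C ` D"
    then obtain x where x: "x \<in> D" "R = C x" by blast
    have "height m P R = card (crossed_walls m P x)"
      by (rule height_eq_card_crossed_walls[OF finP np]) (use x in \<open>auto simp: C_def D_def\<close>)
    then have "height m P R = g (F R)" using F[OF x(1)] gK x by (simp add: D_def)
    then show "monom 1 (coheight m P R) = monom 1 (m * card I - g (F R))"
      by (simp add: coheight_def P card_image[OF inj])
  qed
  also have "\<dots> = (\<Sum>v\<in>F ` C ` D. monom 1 (m * card I - g v))"
    by (rule sum.reindex[symmetric, unfolded o_def]) (auto simp: inj_on_def F CD)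
  also have "F ` C ` D = f ` off_walls m P"
    unfolding fD[symmetric] by (auto simp: F image_iff)
  finally show ?thesis .
qed

subsection \<open>Type A\<close>

text \<open>The positive root \<open>axis i 1 - axis j 1\<close> has \<open>i < j\<close>, so
  dominant points have decreasing coordinates. Enumerating the indices downwards lists the
  coordinates increasingly.\<close>

lemma ex_decreasing_enumeration:
  obtains e :: "nat \<Rightarrow> 'n::{finite,linorder}"
  where "bij_betw e {..<CARD('n)} UNIV"
    and "\<And>k l. k < CARD('n) \<Longrightarrow> l < CARD('n) \<Longrightarrow> e k < e l \<longleftrightarrow> l < k"
proof -
  define xs where "xs = rev (sorted_list_of_set (UNIV :: 'n set))"
  have len: "length xs = CARD('n)" and set: "set xs = UNIV" and dist: "distinct xs"
    by (simp_all add: xs_def)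
  have "sorted_wrt (>) xs"
    using strict_sorted_list_of_set[of "UNIV :: 'n set"] by (simp add: xs_def sorted_wrt_rev)
  then have gt: "xs ! k < xs ! l" if "l < k" "k < CARD('n)" for k l
    using that len by (simp add: sorted_wrt_iff_nth_less)
  show thesis
  proof (rule that[of "(!) xs"])
    show "bij_betw ((!) xs) {..<CARD('n)} UNIV"
      using bij_betw_nth[OF dist] len set by metis
    show "xs ! k < xs ! l \<longleftrightarrow> l < k" if "k < CARD('n)" "l < CARD('n)" for k l
      using gt[of l k] gt[of k l] that by (cases k l rule: linorder_cases) auto
  qed
qed

section \<open>Sublevel sets of finite families of reals\<close>

text \<open>Both sets are initial segments for the same order, so one contains the other, and equal
  finite cardinalities make them equal.\<close>

lemma sublevel_eqI:
  fixes u u' :: "'p \<Rightarrow> real"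
  assumes fin: "finite I"
    and ord: "\<And>p q. p \<in> I \<Longrightarrow> q \<in> I \<Longrightarrow> u p < u q \<longleftrightarrow> u' p < u' q"
    and card: "card {p \<in> I. u p < c} = card {p \<in> I. u' p < c'}"
  shows "{p \<in> I. u p < c} = {p \<in> I. u' p < c'}" (is "?Q = ?Q'")
proof -
  have "?Q \<subseteq> ?Q' \<or> ?Q' \<subseteq> ?Q"
  proof (rule ccontr)
    assume "\<not> ?thesis"
    then obtain p q where p: "p \<in> I" "u p < c" "c' \<le> u' p" and q: "q \<in> I" "u' q < c'" "c \<le> u q"
      by force
    then have "u p < u q" by simp
    then have "u' p < u' q" using ord p q by blast
    then show False using p q by simp
  qed
  then show ?thesis using card fin
    by (metis (no_types, lifting) card_subset_eq finite_subset mem_Collect_eq subsetI)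
qed

text \<open>Raising the level from \<open>a\<close> to the next value of \<open>u\<close> adds
  exactly one element, by injectivity, so every count up to \<open>card I\<close> is reached. The
  result is a whole interval of levels, which leaves freedom to avoid further values.\<close>

lemma ex_sublevel_card:
  fixes u :: "'p \<Rightarrow> real"
  assumes fin: "finite I" and inj: "inj_on u I"
    and lo: "card {p \<in> I. u p \<le> a} \<le> j" and hi: "j \<le> card I"
  obtains b b' where "a \<le> b" "b < b'"
    "\<And>c. b < c \<Longrightarrow> c < b' \<Longrightarrow> card {p \<in> I. u p < c} = j \<and> (\<forall>p\<in>I. u p \<noteq> c)"
proof -
  have "\<exists>b\<ge>a. card {p \<in> I. u p \<le> b} = j"
    using lo hi
  proof (induction j rule: dec_induct)
    case base
    then show ?case by blast
  next
    case (step i)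
    then obtain b where b: "a \<le> b" "card {p \<in> I. u p \<le> b} = i" by auto
    define T where "T = {p \<in> I. b < u p}"
    have finT: "finite T" using fin by (simp add: T_def)
    have "T \<noteq> {}"
    proof
      assume "T = {}"
      then have "{p \<in> I. u p \<le> b} = I" by (force simp: T_def)
      then show False using b step by simp
    qed
    then have "Min (u ` T) \<in> u ` T" using finT by simp
    then obtain q where q: "q \<in> T" "u q = Min (u ` T)" by auto
    then have qm: "u q \<le> u p" if "p \<in> T" for p using finT that by simp
    have "{p \<in> I. u p \<le> u q} = insert q {p \<in> I. u p \<le> b}"
    proof (intro set_eqI iffI)
      fix p assume p: "p \<in> {p \<in> I. u p \<le> u q}"
      show "p \<in> insert q {p \<in> I. u p \<le> b}"
      proof (cases "p \<in> T")
        case True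
        then have "u p = u q" using qm p by force
        then show ?thesis using inj_onD[OF inj, of p q] p q(1) by (simp add: T_def)
      qed (use p in \<open>simp add: T_def\<close>)
    qed (use q(1) in \<open>auto simp: T_def\<close>)
    then have "card {p \<in> I. u p \<le> u q} = Suc i"
      using b q(1) fin by (simp add: T_def)
    then show ?case using b q(1) by (intro exI[of _ "u q"]) (simp add: T_def)
  qed
  then obtain b where b: "a \<le> b" "card {p \<in> I. u p \<le> b} = j" by blast
  \<comment> \<open>Inserting \<open>b + 1\<close> gives an upper end even if no value of
    \<open>u\<close> exceeds \<open>b\<close>.\<close>
  define b' where "b' = Min (insert (b + 1) (u ` {p \<in> I. b < u p}))"
  have b': "b < b'" "\<And>p. p \<in> I \<Longrightarrow> b < u p \<Longrightarrow> b' \<le> u p"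
    using fin by (auto simp: b'_def)
  show thesis
  proof (rule that[OF b(1) b'(1)])
    fix c assume c: "b < c" "c < b'"
    then have "{p \<in> I. u p < c} = {p \<in> I. u p \<le> b}" using b'(2) by force
    moreover have "\<forall>p\<in>I. u p \<noteq> c" using c b'(2) by force
    ultimately show "card {p \<in> I. u p < c} = j \<and> (\<forall>p\<in>I. u p \<noteq> c)" using b by simp
  qed
qed

section \<open>Row counts in type A\<close>

definition row_count :: "nat \<Rightarrow> (nat \<Rightarrow> real) \<Rightarrow> nat \<Rightarrow> nat" where
  "row_count m y k = card {(l, t) \<in> {..<k} \<times> {1..m}. y l + real t < y k}"

definition generic_seq :: "nat \<Rightarrow> nat \<Rightarrow> (nat \<Rightarrow> real) \<Rightarrow> bool" where
  "generic_seq m n y \<longleftrightarrow>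
     (\<forall>k<n. \<forall>l<k. y l < y k \<and> (\<forall>t\<in>{1..m}. y l + real t \<noteq> y k))"

lemma finite_row: "finite {(l, t) \<in> {..<k :: nat} \<times> {1..m :: nat}. Q l t}"
  by (rule finite_subset[of _ "{..<k} \<times> {1..m}"]) auto

lemma row_count_le: "row_count m y k \<le> k * m"
proof -
  have "row_count m y k \<le> card ({..<k} \<times> {1..m})"
    unfolding row_count_def by (intro card_mono) auto
  then show ?thesis by simp
qed

lemma row_count_mono:
  assumes "y k \<le> y (Suc k)"
  shows "row_count m y k \<le> row_count m y (Suc k)"
  unfolding row_count_def
  by (rule card_mono[OF finite_row]) (use assms in auto)

lemma row_count_cong:
  assumes "\<And>l. l \<le> k \<Longrightarrow> y l = y' l"
  shows "row_count m y k = row_count m y' k"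
proof -
  have "{(l, t) \<in> {..<k} \<times> {1..m}. y l + real t < y k} = {(l, t) \<in> {..<k} \<times> {1..m}. y' l + real t < y' k}"
    using assms by auto
  then show ?thesis by (simp add: row_count_def)
qed

text \<open>
  The order of the numbers \<open>y l + t\<close> with \<open>l < k\<close> and \<open>1 \<le> t \<le> m\<close> only involves comparisons
  \<open>y l + t < y l'\<close> with \<open>l < l' < k\<close> and \<open>1 \<le> t < m\<close>. Once the comparisons below \<open>k\<close> are known,
  the position of \<open>y k\<close> is therefore determined by a count.
\<close>

lemma row_counts_determine:
  assumes y: "generic_seq m n y" and y': "generic_seq m n y'"
    and eq: "\<And>k. k < n \<Longrightarrow> row_count m y k = row_count m y' k"
  shows "k < n \<Longrightarrow> l < k \<Longrightarrow> t \<in> {1..m} \<Longrightarrow> y l + real t < y k \<longleftrightarrow> y' l + real t < y' k"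
proof (induction k arbitrary: l t rule: less_induct)
  case (less k)
  define u where "u = (\<lambda>(l, t). y l + real t)"
  define u' where "u' = (\<lambda>(l, t). y' l + real t)"
  let ?I = "{..<k} \<times> {1..m}"
  have mono: "y l < y l'" "y' l < y' l'" if "l < l'" "l' < k" for l l'
    using y y' that less.prems by (auto simp: generic_seq_def)
  have ne: "y l + real t \<noteq> y l'" "y' l + real t \<noteq> y' l'" if "l < l'" "l' < k" "t \<in> {1..m}" for l l' t
    using y y' that less.prems by (auto simp: generic_seq_def)
  have IH: "y l + real t < y l' \<longleftrightarrow> y' l + real t < y' l'" if "l < l'" "l' < k" "t \<in> {1..m}" for l l' t
    using less.IH[of l' l t] that less.prems by auto
  have ord: "u (l, t) < u (l', t') \<longleftrightarrow> u' (l, t) < u' (l', t')"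
    if lt: "(l, t) \<in> ?I" "(l', t') \<in> ?I" for l t l' t'
  proof -
    \<comment> \<open>For \<open>t \<le> t'\<close> in the second case and \<open>t' \<le> t\<close>
      in the fourth, monotonicity decides the comparison alike on both sides. The third and fifth
      cases move the difference of \<open>t\<close> and \<open>t'\<close> to one side, giving a
      comparison within an earlier row; in the fifth it is reversed, and \<open>ne\<close> excludes
      equality.\<close>
    consider "l = l'" | "l < l'" "t \<le> t'" | "l < l'" "t' < t" | "l' < l" "t' \<le> t" | "l' < l" "t < t'"
      by linarith
    then show ?thesis
    proof cases
      case 2
      then show ?thesis using mono[of l l'] lt by (auto simp: u_def u'_def)
    next
      case 3
      then have "t - t' \<in> {1..m}" using lt by auto
      from IH[OF _ _ this, of l l'] show ?thesis
        using 3 lt by (simp add: u_def u'_def of_nat_diff algebra_simps)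
    next
      case 4
      then show ?thesis using mono[of l' l] lt by (auto simp: u_def u'_def)
    next
      case 5
      then have "t' - t \<in> {1..m}" using lt by auto
      from IH[OF _ _ this, of l' l] ne[OF _ _ this, of l' l] show ?thesis
        using 5 lt by (auto simp: u_def u'_def of_nat_diff algebra_simps)
    qed (auto simp: u_def u'_def)
  qed
  have "{p \<in> ?I. u p < y k} = {p \<in> ?I. u' p < y' k}"
  proof (rule sublevel_eqI)
    have "row_count m y k = card {p \<in> ?I. u p < y k}" "row_count m y' k = card {p \<in> ?I. u' p < y' k}"
      by (auto simp: row_count_def u_def u'_def intro!: arg_cong[of _ _ card])
    then show "card {p \<in> ?I. u p < y k} = card {p \<in> ?I. u' p < y' k}"
      using eq[OF less.prems(1)] by simp
  qed (use ord in auto)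
  then have "(l, t) \<in> {p \<in> ?I. u p < y k} \<longleftrightarrow> (l, t) \<in> {p \<in> ?I. u' p < y' k}" by simp
  then show ?case using less.prems by (simp add: u_def u'_def)
qed

text \<open>The entry \<open>y n\<close> must exceed \<open>y (n - 1)\<close> and exactly
  \<open>v n\<close> of the values \<open>y l + t\<close>. At most \<open>v (n - 1)\<close> of them
  lie below \<open>y (n - 1)\<close>, so such a level exists. Demanding non-integral differences,
  more than \<open>generic_seq\<close> asks for, makes these values distinct and supports the
  induction.\<close>

lemma ex_seq_row_counts:
  assumes "\<And>k. k < n \<Longrightarrow> v k \<le> k * m" and "\<And>k. Suc k < n \<Longrightarrow> v k \<le> v (Suc k)"
  shows "\<exists>y. (\<forall>k<n. \<forall>l<k. y l < y k \<and> y k - y l \<notin> \<int>) \<and> (\<forall>k<n. row_count m y k = v k)"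
  using assms
proof (induction n)
  case 0
  then show ?case by auto
next
  case (Suc n)
  then obtain y where y: "\<forall>k<n. \<forall>l<k. y l < y k \<and> y k - y l \<notin> \<int>" "\<forall>k<n. row_count m y k = v k"
    by auto
  have mono: "y l < y k" if "l < k" "k < n" for k l using y that by blast
  define u where "u = (\<lambda>(l, t). y l + real t)"
  let ?I = "{..<n} \<times> {1..m}"
  have inj: "inj_on u ?I"
  proof (rule inj_onI, clarify)
    fix l t l' t' assume l: "l < n" "l' < n" and e: "u (l, t) = u (l', t')"
    have "y l - y l' = of_int (int t' - int t)" "y l' - y l = of_int (int t - int t')"
      using e by (simp_all add: u_def)
    then have "y l - y l' \<in> \<int>" "y l' - y l \<in> \<int>" using Ints_of_int by metis+
    then have "l = l'" using y(1) l by (cases l l' rule: linorder_cases) auto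
    then show "l = l' \<and> t = t'" using e by (simp add: u_def)
  qed
  \<comment> \<open>For \<open>n = 0\<close> this is the arbitrary number \<open>y 0\<close>; there
    are then no earlier entries to compare with.\<close>
  define a where "a = y (n - 1)"
  have le_a: "y l \<le> a" if "l < n" for l
    using mono[of l "n - 1"] that unfolding a_def by (cases "l = n - 1") (auto intro!: less_imp_le)
  have lo: "card {p \<in> ?I. u p \<le> a} \<le> v n"
  proof (cases n)
    case 0
    then show ?thesis by simp
  next
    case (Suc n')
    \<comment> \<open>The last index \<open>n'\<close> contributes nothing at its own level since
      \<open>t \<ge> 1\<close>, and non-integrality turns \<open>\<le>\<close> into
      \<open><\<close>; what remains is the previous row.\<close>
    have "{p \<in> ?I. u p \<le> a} \<subseteq> {(l, t) \<in> {..<n'} \<times> {1..m}. y l + real t < y n'}"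
    proof clarify
      fix l t assume lt: "l < n" "t \<in> {1..m}" "u (l, t) \<le> a"
      then have "l \<noteq> n'" using Suc by (auto simp: u_def a_def)
      then have "l < n'" using lt Suc by simp
      have "y l + real t \<noteq> y n'"
      proof
        assume "y l + real t = y n'"
        then have "y n' - y l = of_nat t" by simp
        then show False using y(1) \<open>l < n'\<close> Suc by (metis Ints_of_nat lessI)
      qed
      then show "(l, t) \<in> {..<n'} \<times> {1..m} \<and> y l + real t < y n'"
        using lt \<open>l < n'\<close> Suc by (simp add: u_def a_def)
    qed
    then have "card {p \<in> ?I. u p \<le> a} \<le> row_count m y n'"
      unfolding row_count_def by (rule card_mono[OF finite_row])
    also have "\<dots> = v n'" using y(2) Suc by simp
    also have "\<dots> \<le> v n" using Suc.prems(2)[of n'] Suc by simp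
    finally show ?thesis .
  qed
  have hi: "v n \<le> card ?I" using Suc.prems(1)[of n] by simp
  obtain b b' where b: "a \<le> b" "b < b'"
    "\<And>c. b < c \<Longrightarrow> c < b' \<Longrightarrow> card {p \<in> ?I. u p < c} = v n \<and> (\<forall>p\<in>?I. u p \<noteq> c)"
    using ex_sublevel_card[OF _ inj lo hi] by blast
  \<comment> \<open>Keeping the differences non-integral excludes only countably many points of the
    interval.\<close>
  have "countable (\<Union>l<n. (+) (y l) ` \<int>)" by (intro countable_UN countable_image countable_int) auto
  then have "uncountable ({b<..<b'} - (\<Union>l<n. (+) (y l) ` \<int>))"
    by (intro uncountable_minus_countable) (use b(2) uncountable_open_interval in auto)
  then obtain c where "c \<in> {b<..<b'} - (\<Union>l<n. (+) (y l) ` \<int>)"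
    by (metis countable_empty ex_in_conv)
  then have c: "b < c" "c < b'" "c \<notin> (\<Union>l<n. (+) (y l) ` \<int>)"
    by (auto simp only: Diff_iff greaterThanLessThan_iff)
  define y' where "y' = y(n := c)"
  have "c - y l \<notin> \<int>" if "l < n" for l
  proof
    assume "c - y l \<in> \<int>"
    then have "y l + (c - y l) \<in> (+) (y l) ` \<int>" by blast
    then show False using c(3) that by auto
  qed
  then have "\<forall>k<Suc n. \<forall>l<k. y' l < y' k \<and> y' k - y' l \<notin> \<int>"
    using y(1) c b le_a by (fastforce simp: y'_def less_Suc_eq)
  moreover have "row_count m y' k = v k" if "k < Suc n" for k
  proof (cases "k = n")
    case True
    have "{(l, t) \<in> {..<n} \<times> {1..m}. y' l + real t < y' n} = {p \<in> ?I. u p < c}"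
      by (auto simp: y'_def u_def)
    then show ?thesis using b(3) c True by (simp add: row_count_def)
  next
    case False
    then have "row_count m y' k = row_count m y k" using that by (intro row_count_cong) (simp add: y'_def)
    then show ?thesis using False that y(2) by simp
  qed
  ultimately show ?case by blast
qed

section \<open>Type A regions and row vectors\<close>

text \<open>These are the partitions inside the staircase, read backwards and padded with zeros to
  length \<open>n\<close>.\<close>

definition row_vectors_A :: "nat \<Rightarrow> nat \<Rightarrow> nat list set" where
  "row_vectors_A m n = {v. length v = n \<and> (\<forall>k<n. v ! k \<le> k * m) \<and> (\<forall>k. Suc k < n \<longrightarrow> v ! k \<le> v ! Suc k)}"

text \<open>At a nonzero coordinate of \<open>\<alpha>\<close> both vectors have entries of absolute
  value 1, and a positive factor cannot change the sign.\<close>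

lemma no_parallel_roots:
  fixes P :: "(real ^ 'n) set"
  assumes P: "\<And>\<alpha>. \<alpha> \<in> P \<Longrightarrow> (\<forall>i. \<alpha> $ i \<in> {-1, 0, 1}) \<and> \<alpha> \<noteq> 0"
    and "\<alpha> \<in> P" "\<beta> \<in> P" "0 < c" "\<alpha> = c *\<^sub>R \<beta>"
  shows "c = 1"
proof -
  obtain i where i: "\<alpha> $ i \<noteq> 0" using P[OF assms(2)] by (auto simp: vec_eq_iff)
  have "\<alpha> $ i = c * \<beta> $ i" using assms(5) by simp
  moreover have "\<alpha> $ i \<in> {-1, 0, 1}" "\<beta> $ i \<in> {-1, 0, 1}" using P assms by blast+
  ultimately show ?thesis using i assms(4) by auto
qed

lemma sum_lessThan_eq_choose_two: "(\<Sum>k<n. k) = n choose 2"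
  by (induction n) (simp_all add: numeral_2_eq_2)

text \<open>The vector of row counts serves as the invariant in \<open>Cat_Shi_eq_sum\<close>:
  \<open>row_counts_determine\<close> shows that it separates regions,
  \<open>ex_seq_row_counts\<close> determines its image, and its sum is the number of crossed
  walls.\<close>

lemma Cat_Shi_A_eq_row_vectors:
  fixes m :: nat
  assumes m: "1 \<le> m"
  shows "Cat_Shi m (pos_roots_A :: (real ^ 'n::{finite,linorder}) set) =
    (\<Sum>v\<in>row_vectors_A m CARD('n). monom 1 (m * (CARD('n) choose 2) - sum_list v))"
proof -
  let ?n = "CARD('n)"
  let ?P = "pos_roots_A :: ((real, 'n) vec) set"
  obtain e :: "nat \<Rightarrow> 'n" where e: "bij_betw e {..<?n} UNIV"
    "\<And>k l. k < ?n \<Longrightarrow> l < ?n \<Longrightarrow> e k < e l \<longleftrightarrow> l < k"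
    using ex_decreasing_enumeration by metis
  have e_eq: "e k = e l \<longleftrightarrow> k = l" if "k < ?n" "l < ?n" for k l
    using e(1) that by (auto simp: bij_betw_def inj_on_def)
  define I where "I = (SIGMA k:{..<?n}. {..<k})"
  define \<rho> where "\<rho> = (\<lambda>(k, l). axis (e k) 1 - axis (e l) 1 :: (real, 'n) vec)"
  define y where "y x k = x $ e k" for x :: "(real, 'n) vec" and k
  define f where "f x = map (row_count m (y x)) [0..<?n]" for x
  have in_I: "(k, l) \<in> I \<longleftrightarrow> k < ?n \<and> l < k" for k l by (auto simp: I_def)
  have surj_e: "\<exists>k<?n. e k = i" for i
    using e(1) by (metis UNIV_I bij_betw_imp_surj_on imageE lessThan_iff)
  have P: "?P = \<rho> ` I"
  proof
    show "?P \<subseteq> \<rho> ` I"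
    proof
      fix \<alpha> assume "\<alpha> \<in> ?P"
      then obtain i j where ij: "\<alpha> = axis i 1 - axis j 1" "i < j" by (auto simp: pos_roots_A_def)
      obtain k l where "k < ?n" "e k = i" "l < ?n" "e l = j" using surj_e by metis
      then show "\<alpha> \<in> \<rho> ` I" using ij e(2)[of k l]
        by (intro image_eqI[of _ _ "(k, l)"]) (auto simp: in_I \<rho>_def)
    qed
    show "\<rho> ` I \<subseteq> ?P" 
    proof (rule image_subsetI)
      fix p assume "p \<in> I"
      then obtain k l where p: "p = (k, l)" "k < ?n" "l < k" by (auto simp: I_def)
      then have "e k < e l" using e(2) by simp
      then show "\<rho> p \<in> ?P" unfolding p(1) by (auto simp: \<rho>_def pos_roots_A_def)
    qed
  qed
  have inner: "\<rho> (k, l) \<bullet> x = y x k - y x l" for k l x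
    by (simp add: \<rho>_def y_def inner_diff_left inner_axis')
  have inj: "inj_on \<rho> I"
  proof (rule inj_onI, clarify)
    fix k l k' l' assume kl: "(k, l) \<in> I" "(k', l') \<in> I" and eq: "\<rho> (k, l) = \<rho> (k', l')"
    have c: "\<rho> (k, l) $ e j = (if j = k then 1 else 0) - (if j = l then 1 else 0)"
      if "(k, l) \<in> I" "j < ?n" for k l j
      using that e_eq[of j k] e_eq[of j l] by (auto simp: \<rho>_def in_I axis_def)
    have "k = k'" using c[OF kl(1), of k] c[OF kl(2), of k] kl eq
      by (auto simp: in_I split: if_splits)
    moreover have "l = l'" using c[OF kl(1), of l] c[OF kl(2), of l] kl eq
      by (auto simp: in_I split: if_splits)
    ultimately show "k = k' \<and> l = l'" by simp
  qed
  have off: "x \<in> off_walls m ?P \<longleftrightarrow> generic_seq m ?n (y x)" for x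
  proof -
    have "x \<in> off_walls m ?P \<longleftrightarrow>
        (\<forall>p\<in>I. 0 < \<rho> p \<bullet> x \<and> (\<forall>t\<in>{1..m}. \<rho> p \<bullet> x \<noteq> real t))"
      unfolding off_walls_def P by auto
    also have "\<dots> \<longleftrightarrow> generic_seq m ?n (y x)"
    proof -
      have "y x k - y x l = real t \<longleftrightarrow> y x l + real t = y x k" for k l t by auto
      then show ?thesis by (auto simp: generic_seq_def I_def inner)
    qed
    finally show ?thesis .
  qed
  have card_I: "card I = ?n choose 2"
  proof -
    have "card I = (\<Sum>k<?n. k)" by (simp add: I_def)
    also have "\<dots> = ?n choose 2"
      by (rule sum_lessThan_eq_choose_two)
    finally show ?thesis .
  qed
  have "Cat_Shi m ?P = (\<Sum>v\<in>f ` off_walls m ?P. monom 1 (m * card I - sum_list v))"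
  proof (rule Cat_Shi_eq_sum[OF m _ P inj])
    show "finite I" by (simp add: I_def)
    show "c = 1" if "\<alpha> \<in> ?P" "\<beta> \<in> ?P" "0 < c" "\<alpha> = c *\<^sub>R \<beta>" for \<alpha> \<beta> :: "(real, 'n) vec" and c
    proof (rule no_parallel_roots[OF _ that])
      fix \<alpha> :: "(real, 'n) vec" assume "\<alpha> \<in> ?P"
      then obtain i j where ij: "\<alpha> = axis i 1 - axis j 1" "i < j" by (auto simp: pos_roots_A_def)
      then have "\<alpha> $ i = 1" by (simp add: axis_def)
      then have "\<alpha> \<noteq> 0" by auto
      then show "(\<forall>i. \<alpha> $ i \<in> {-1, 0, 1}) \<and> \<alpha> \<noteq> 0" using ij by (auto simp: axis_def)
    qed
    show "f x = f x' \<longleftrightarrow> (\<forall>i\<in>I. \<forall>t\<in>{1..m}. real t < \<rho> i \<bullet> x \<longleftrightarrow> real t < \<rho> i \<bullet> x')"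
      if "x \<in> off_walls m ?P" "x' \<in> off_walls m ?P" for x x'
    proof -
      have gen: "generic_seq m ?n (y x)" "generic_seq m ?n (y x')" using that off by auto
      have "f x = f x' \<longleftrightarrow> (\<forall>k<?n. row_count m (y x) k = row_count m (y x') k)"
        by (auto simp: f_def)
      also have "\<dots> \<longleftrightarrow> (\<forall>k<?n. \<forall>l<k. \<forall>t\<in>{1..m}. y x l + real t < y x k \<longleftrightarrow> y x' l + real t < y x' k)"
      proof (rule iffI; intro allI impI)
        fix k l
        assume "\<forall>k<?n. row_count m (y x) k = row_count m (y x') k" and kl: "k < ?n" "l < k"
        then have "row_count m (y x) k = row_count m (y x') k" if "k < ?n" for k using that by blast
        from row_counts_determine[OF gen this kl]
        show "\<forall>t\<in>{1..m}. y x l + real t < y x k \<longleftrightarrow> y x' l + real t < y x' k" by (rule ballI)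
      next
        fix k assume h: "\<forall>k<?n. \<forall>l<k. \<forall>t\<in>{1..m}. y x l + real t < y x k \<longleftrightarrow> y x' l + real t < y x' k"
          and k: "k < ?n"
        show "row_count m (y x) k = row_count m (y x') k"
          unfolding row_count_def
        proof (intro arg_cong[of _ _ card] set_eqI)
          fix p :: "nat \<times> nat"
          obtain l t where p: "p = (l, t)" by (cases p)
          show "p \<in> {(l, t) \<in> {..<k} \<times> {1..m}. y x l + real t < y x k} \<longleftrightarrow>
              p \<in> {(l, t) \<in> {..<k} \<times> {1..m}. y x' l + real t < y x' k}"
            unfolding p mem_Collect_eq case_prod_conv mem_Sigma_iff lessThan_iff using h k by blast
        qed
      qed
      also have "\<dots> \<longleftrightarrow> (\<forall>i\<in>I. \<forall>t\<in>{1..m}. real t < \<rho> i \<bullet> x \<longleftrightarrow> real t < \<rho> i \<bullet> x')"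
      proof -
        have "real t < \<rho> (k, l) \<bullet> x \<longleftrightarrow> y x l + real t < y x k" for k l t x
          unfolding inner by linarith
        then show ?thesis
          unfolding I_def split_paired_Ball_Sigma by (simp only: Ball_def lessThan_iff)
      qed
      finally show ?thesis .
    qed
    show "sum_list (f x) = card {(i, t). i \<in> I \<and> t \<in> {1..m} \<and> real t < \<rho> i \<bullet> x}" for x
    proof -
      let ?S = "SIGMA k:{..<?n}. {(l, t) \<in> {..<k} \<times> {1..m}. y x l + real t < y x k}"
      have "sum_list (f x) = (\<Sum>k<?n. row_count m (y x) k)"
        by (simp add: f_def interv_sum_list_conv_sum_set_nat atLeast0LessThan)
      also have "\<dots> = card ?S"
        unfolding row_count_def by (rule card_SigmaI[symmetric]) (rule finite_lessThan, rule ballI, rule finite_row)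
      also have "\<dots> = card {(i, t). i \<in> I \<and> t \<in> {1..m} \<and> real t < \<rho> i \<bullet> x}"
        by (rule bij_betw_same_card[of "\<lambda>(k, l, t). ((k, l), t)"],
            rule bij_betwI[of _ _ _ "\<lambda>((k, l), t). (k, l, t)"])
          (auto simp: in_I inner algebra_simps)
      finally show ?thesis .
    qed
  qed
  also have "f ` off_walls m ?P = row_vectors_A m ?n"
  proof
    show "f ` off_walls m ?P \<subseteq> row_vectors_A m ?n"
    proof
      fix v assume "v \<in> f ` off_walls m ?P"
      then obtain x where x: "generic_seq m ?n (y x)" "v = f x" using off by auto
      then have "y x k \<le> y x (Suc k)" if "Suc k < ?n" for k
        using that by (force simp: generic_seq_def)
      then show "v \<in> row_vectors_A m ?n"
        using x by (auto simp: row_vectors_A_def f_def row_count_le row_count_mono)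
    qed
    show "row_vectors_A m ?n \<subseteq> f ` off_walls m ?P"
    proof
      fix v assume v: "v \<in> row_vectors_A m ?n"
      obtain z where z: "\<forall>k<?n. \<forall>l<k. z l < z k \<and> z k - z l \<notin> \<int>" "\<forall>k<?n. row_count m z k = v ! k"
        using ex_seq_row_counts[of ?n "(!) v" m] v by (auto simp: row_vectors_A_def)
      \<comment> \<open>Coordinate \<open>e k\<close> of \<open>x\<close> is \<open>z k\<close>; the
        coordinate sum is left arbitrary, so \<open>x\<close> may lie outside the span of the
        roots.\<close>
      define x :: "(real, 'n) vec" where "x = (\<chi> i. z (the_inv_into {..<?n} e i))"
      have yz: "y x k = z k" if "k < ?n" for k
        using e(1) that by (simp add: y_def x_def the_inv_into_f_f bij_betw_def)
      have "generic_seq m ?n (y x)"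
        unfolding generic_seq_def
      proof (intro allI impI conjI ballI)
        fix k l assume kl: "k < ?n" "l < k"
        then show "y x l < y x k" using z(1) yz by simp
        fix t assume "t \<in> {1..m}"
        show "y x l + real t \<noteq> y x k"
        proof
          assume "y x l + real t = y x k"
          then have "z k - z l = of_nat t" using kl yz by simp
          then show False using z(1) kl by (metis Ints_of_nat)
        qed
      qed
      moreover have "f x = v"
      proof (rule nth_equalityI)
        show "length (f x) = length v" using v by (simp add: f_def row_vectors_A_def)
        fix k assume "k < length (f x)"
        then have k: "k < ?n" by (simp add: f_def)
        have "row_count m (y x) k = row_count m z k" by (rule row_count_cong) (use k yz in auto)
        then show "f x ! k = v ! k" using z(2) k by (simp add: f_def)
      qed
      ultimately show "v \<in> f ` off_walls m ?P" using off by blast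
    qed
  qed
  finally show ?thesis by (simp add: card_I)
qed

section \<open>Partitions and row vectors\<close>

text \<open>Zeros come first in a sorted list of naturals. Hence length and nonzero entries
  determine the list, which inverts the deletion of zeros for partitions and for paths.\<close>

lemma sorted_eq_zeros_append:
  fixes v :: "nat list"
  assumes "sorted v"
  shows "v = replicate (length v - length (filter (\<lambda>a. a \<noteq> 0) v)) 0 @ filter (\<lambda>a. a \<noteq> 0) v"
  using assms
proof (induction v)
  case (Cons a v)
  show ?case
  proof (cases "a = 0")
    case True
    then show ?thesis using Cons by (simp add: Suc_diff_le)
  next
    case False
    then have "filter (\<lambda>a. a \<noteq> 0) v = v" using Cons.prems by (auto intro!: filter_True)
    then show ?thesis using False by simp
  qed
qed simp

text \<open>Reversal sends part number \<open>n - k\<close> to entry \<open>k\<close>, so the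
  staircase bound becomes \<open>k * m\<close>; padding with zeros keeps the sum.\<close>

lemma Cat_A_eq_row_vectors:
  "Cat_A m n = (\<Sum>v\<in>row_vectors_A m n. monom 1 (m * (n choose 2) - sum_list v))"
proof -
  define i where "i p = replicate (n - length p) 0 @ rev p" for p :: "nat list"
  define j where "j v = rev (filter (\<lambda>a. a \<noteq> 0) v)" for v :: "nat list"
  have len_st: "length (staircase m n) = n - 1" by (simp add: staircase_def)
  have st: "staircase m n ! k = (n - Suc k) * m" if "k < n - 1" for k
    using that by (simp add: staircase_def)
  show ?thesis
    unfolding Cat_A_def
  proof (rule sum.reindex_bij_witness[of _ j i])
    fix p assume "p \<in> catalan_partitions m n"
    then have p: "sorted_wrt (\<ge>) p" "0 \<notin> set p" "length p \<le> n - 1"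
      "\<And>k. k < length p \<Longrightarrow> p ! k \<le> (n - Suc k) * m"
      using len_st st by (auto simp: catalan_partitions_def is_partition_def fits_inside_def)
    have "filter (\<lambda>a. a \<noteq> 0) (rev p) = rev p" using p(2) by (intro filter_True ballI notI) simp
    then show "j (i p) = p" by (simp add: i_def j_def filter_replicate)
    show "monom 1 (m * (n choose 2) - sum_list (i p)) = monom 1 (area_A m n p)"
      by (simp add: i_def area_A_def sum_list_rev sum_list_replicate)
    have len: "length (i p) = n" using p by (simp add: i_def)
    have nth: "i p ! k = (if k < n - length p then 0 else p ! (n - Suc k))" if "k < n" for k
      using that p(3) by (auto simp: i_def nth_append rev_nth)
    have "i p ! k \<le> k * m" if "k < n" for k
      using p(4)[of "n - Suc k"] that by (auto simp: nth)
    moreover have "i p ! k \<le> i p ! Suc k" if "Suc k < n" for k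
      using that sorted_wrt_nth_less[OF p(1), of "n - Suc (Suc k)" "n - Suc k"] by (auto simp: nth)
    ultimately show "i p \<in> row_vectors_A m n" using len by (simp add: row_vectors_A_def)
  next
    fix v assume "v \<in> row_vectors_A m n"
    then have v: "length v = n" "\<And>k. k < n \<Longrightarrow> v ! k \<le> k * m" "\<And>k. Suc k < n \<Longrightarrow> v ! k \<le> v ! Suc k"
      by (auto simp: row_vectors_A_def)
    have sorted: "sorted v" using v by (simp add: sorted_iff_nth_Suc)
    show ij: "i (j v) = v" using sorted_eq_zeros_append[OF sorted] v(1) by (simp add: i_def j_def)
    \<comment> \<open>Entry 0 is bounded by 0, so at least one entry is deleted and at most
      \<open>n - 1\<close> parts remain.\<close>
    have len: "length (j v) \<le> n - 1"
    proof (cases "n = 0")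
      case False
      then have "v ! 0 = 0" using v(2)[of 0] by simp
      moreover have "v ! 0 \<in> set v" using False v(1) by (intro nth_mem) simp
      ultimately have "length (filter (\<lambda>a. a \<noteq> 0) v) < length v"
        by (intro length_filter_less[of "v ! 0"]) simp_all
      then show ?thesis using v(1) by (simp add: j_def)
    qed (use v in \<open>simp add: j_def\<close>)
    have "j v ! k = v ! (n - Suc k)" if "k < length (j v)" for k
    proof -
      have "v ! (n - Suc k) = i (j v) ! (n - Suc k)" using ij by simp
      also have "\<dots> = j v ! k" using that len by (auto simp: i_def nth_append rev_nth)
      finally show ?thesis by simp
    qed
    then have "j v ! k \<le> staircase m n ! k" if "k < length (j v)" for k
      using v(2)[of "n - Suc k"] st[of k] that len by auto
    moreover have "is_partition (j v)"
      using sorted by (auto simp: is_partition_def j_def sorted_wrt_rev intro!: sorted_wrt_filter)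
    ultimately show "j v \<in> catalan_partitions m n"
      using len len_st by (simp add: catalan_partitions_def fits_inside_def)
  qed
qed

subsection \<open>Positive regions of type B\<close>

text \<open>
  Put \<open>Y 0 = 0\<close>, \<open>Y (k + 1) = y k\<close> and \<open>Y (- j) = - Y j\<close>. The roots of type \<open>B\<close> are then uniformly
  the differences \<open>y k - Y j\<close> with \<open>\<bar>j\<bar> \<le> k\<close>.
\<close>

definition signed_seq :: "(nat \<Rightarrow> real) \<Rightarrow> int \<Rightarrow> real" where
  "signed_seq y j = of_int (sgn j) * y (nat \<bar>j\<bar> - 1)"

lemma signed_seq_0 [simp]: "signed_seq y 0 = 0"
  and signed_seq_minus [simp]: "signed_seq y (- j) = - signed_seq y j"
  and signed_seq_Suc [simp]: "signed_seq y (int k + 1) = y k"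
  by (simp_all add: signed_seq_def sgn_minus nat_add_distrib)

lemma signed_seq_cong:
  assumes "\<And>l. l < k \<Longrightarrow> y l = y' l" "\<bar>j\<bar> \<le> int k"
  shows "signed_seq y j = signed_seq y' j"
proof (cases "j = 0")
  case False
  then have "nat \<bar>j\<bar> - 1 < k" using assms(2) by linarith
  then show ?thesis using assms(1) by (simp add: signed_seq_def)
qed simp

definition dominant_seq_B :: "nat \<Rightarrow> (nat \<Rightarrow> real) \<Rightarrow> bool" where
  "dominant_seq_B n y \<longleftrightarrow> (\<forall>k<n. \<forall>j. \<bar>j\<bar> \<le> int k \<longrightarrow> signed_seq y j < y k)"

definition generic_seq_B :: "nat \<Rightarrow> (nat \<Rightarrow> real) \<Rightarrow> bool" where
  "generic_seq_B n y \<longleftrightarrow>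
     dominant_seq_B n y \<and> (\<forall>k<n. \<forall>j. \<bar>j\<bar> \<le> int k \<longrightarrow> signed_seq y j + 1 \<noteq> y k)"

definition row_count_B :: "(nat \<Rightarrow> real) \<Rightarrow> nat \<Rightarrow> nat" where
  "row_count_B y k = card {j \<in> {- int k..int k}. signed_seq y j + 1 < y k}"

text \<open>The definition compares an index with one of larger absolute value. If the larger
  absolute value belongs to \<open>i\<close>, negating both sides reduces to this; if
  \<open>j = - i\<close>, both values are compared with 0.\<close>

lemma signed_seq_strict_mono:
  assumes y: "dominant_seq_B n y" and ij: "i < j" "- int n \<le> i" "j \<le> int n"
  shows "signed_seq y i < signed_seq y j"
proof -
  have top: "signed_seq y p < signed_seq y q" if "\<bar>p\<bar> < q" "q \<le> int n" for p q
  proof -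
    define k where "k = nat (q - 1)"
    then have k: "q = int k + 1" "k < n" "\<bar>p\<bar> \<le> int k" using that by auto
    then show ?thesis using y by (simp add: dominant_seq_B_def)
  qed
  consider "\<bar>i\<bar> < j" | "\<bar>j\<bar> < - i" | "j = - i" "0 < j" using ij by linarith
  then show ?thesis
  proof cases
    case 1
    then show ?thesis using top ij by blast
  next
    case 2
    then have "signed_seq y (- j) < signed_seq y (- i)" using ij by (intro top) auto
    then show ?thesis by simp
  next
    case 3
    then have "0 < signed_seq y j" using top[of 0 j] ij by simp
    then show ?thesis using 3 by simp
  qed
qed

lemma dominant_seq_B_mono: "dominant_seq_B n y \<Longrightarrow> k \<le> n \<Longrightarrow> dominant_seq_B k y"
  by (simp add: dominant_seq_B_def)

lemma signed_seq_less_iff: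
  assumes "dominant_seq_B n y" "i \<in> {- int n..int n}" "j \<in> {- int n..int n}"
  shows "signed_seq y i < signed_seq y j \<longleftrightarrow> i < j"
  using signed_seq_strict_mono[OF assms(1), of i j] signed_seq_strict_mono[OF assms(1), of j i] assms(2,3)
  by (cases i j rule: linorder_cases) auto

text \<open>For \<open>m = 1\<close> the values \<open>signed_seq y j + 1\<close> are ordered as
  their indices in every dominant sequence. A single count therefore fixes its row, without the
  induction over earlier rows used in type A.\<close>

lemma row_counts_determine_B:
  assumes y: "generic_seq_B n y" "generic_seq_B n y'"
    and k: "k < n" "row_count_B y k = row_count_B y' k" "j \<in> {- int k..int k}"
  shows "signed_seq y j + 1 < y k \<longleftrightarrow> signed_seq y' j + 1 < y' k"
proof -
  have dom: "dominant_seq_B k y" "dominant_seq_B k y'"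
    using y k dominant_seq_B_mono by (auto simp: generic_seq_B_def)
  have "{j \<in> {- int k..int k}. signed_seq y j + 1 < y k} =
      {j \<in> {- int k..int k}. signed_seq y' j + 1 < y' k}"
    by (rule sublevel_eqI) (use k(2) in \<open>simp_all only: row_count_B_def add_less_cancel_right
      signed_seq_less_iff[OF dom(1)] signed_seq_less_iff[OF dom(2)] finite_atLeastAtMost_int\<close>)
  then show ?thesis using k(3) by blast
qed

lemma row_count_B_le: "row_count_B y k \<le> 2 * k + 1"
proof -
  have "row_count_B y k \<le> card {- int k..int k}"
    unfolding row_count_B_def by (rule card_mono) auto
  then show ?thesis by simp
qed

text \<open>Every index counted in row \<open>k\<close> is counted again in the next row. If there
  is such a \<open>j\<close>, then \<open>1 - y k < 1 + signed_seq y j < y k\<close>, so the new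
  index \<open>- (int k + 1)\<close> is counted in the next row as well.\<close>

lemma row_count_B_strict_mono:
  assumes y: "dominant_seq_B n y" and k: "Suc k < n" and ne: "row_count_B y k \<noteq> 0"
  shows "row_count_B y k < row_count_B y (Suc k)"
proof -
  let ?S = "\<lambda>k. {j \<in> {- int k..int k}. signed_seq y j + 1 < y k}"
  have lt: "signed_seq y j < y k" if "\<bar>j\<bar> \<le> int k" "k < n" for j k
    using y that by (simp add: dominant_seq_B_def)
  have inc: "y k < y (Suc k)" using lt[of "int k + 1" "Suc k"] k by simp
  have "?S k \<noteq> {}" using ne unfolding row_count_B_def by (metis card.empty)
  then obtain j where "j \<in> ?S k" by blast
  then have j: "\<bar>j\<bar> \<le> int k" "signed_seq y j + 1 < y k" by auto
  have "- signed_seq y j < y k" using lt[of "- j" k] j(1) k by simp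
  then have "- (int k + 1) \<in> ?S (Suc k)"
    using j(2) inc signed_seq_minus[of y "int k + 1"] by (simp del: signed_seq_minus)
  moreover have "- (int k + 1) \<notin> ?S k" by simp
  moreover have "?S k \<subseteq> ?S (Suc k)" using inc by auto
  ultimately have "?S k \<subset> ?S (Suc k)" by blast
  moreover have "finite (?S (Suc k))" by (rule finite_subset[of _ "{- int (Suc k)..int (Suc k)}"]) auto
  ultimately show ?thesis unfolding row_count_B_def by (intro psubset_card_mono)
qed

lemma row_count_B_cong:
  assumes "\<And>l. l \<le> k \<Longrightarrow> y l = y' l"
  shows "row_count_B y k = row_count_B y' k"
proof -
  have "signed_seq y j = signed_seq y' j" if "j \<in> {- int k..int k}" for j
    using that assms by (intro signed_seq_cong[of k]) auto
  then have "{j \<in> {- int k..int k}. signed_seq y j + 1 < y k} = {j \<in> {- int k..int k}. signed_seq y' j + 1 < y' k}"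
    using assms[of k] by (intro Collect_cong conj_cong) auto
  then show ?thesis by (simp add: row_count_B_def)
qed

text \<open>
  The condition \<open>y k < 1 / 2\<close> in empty rows leaves room for the next row to be empty as well, which
  needs \<open>y k < y (k + 1) < 1 - y k\<close>.
\<close>

lemma ex_seq_row_counts_B:
  assumes "\<And>k. k < n \<Longrightarrow> v k \<le> 2 * k + 1" and "\<And>k. Suc k < n \<Longrightarrow> v k < v (Suc k) \<or> v k = 0"
  shows "\<exists>y. generic_seq_B n y \<and> (\<forall>k<n. row_count_B y k = v k \<and> (v k = 0 \<longrightarrow> y k < 1 / 2))"
  using assms
proof (induction n)
  case 0
  then show ?case by (auto simp: generic_seq_B_def dominant_seq_B_def)
next
  case (Suc n)
  then obtain y where y: "generic_seq_B n y" "\<forall>k<n. row_count_B y k = v k \<and> (v k = 0 \<longrightarrow> y k < 1 / 2)"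
    by auto
  have dom: "dominant_seq_B n y" using y(1) by (simp add: generic_seq_B_def)
  define Y where "Y = signed_seq y"
  \<comment> \<open>This is the largest earlier value: \<open>y (n - 1)\<close>, or 0 if
    \<open>n = 0\<close>.\<close>
  define a where "a = Y (int n)"
  let ?I = "{- int n..int n}"
  have mono: "Y i < Y j \<longleftrightarrow> i < j" if "i \<in> ?I" "j \<in> ?I" for i j
    unfolding Y_def using signed_seq_less_iff[OF dom that] .
  have mono_le: "Y i \<le> Y j \<longleftrightarrow> i \<le> j" if "i \<in> ?I" "j \<in> ?I" for i j
    using mono[OF that(2,1)] by linarith
  have Y_minus: "Y (- int n) = - a" by (simp add: Y_def a_def)
  have bounds: "Y j \<le> a" "- a \<le> Y j" if "j \<in> ?I" for j
    using mono_le[of j "int n"] mono_le[of "- int n" j] that Y_minus by (auto simp: a_def)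
  have a_Suc: "a = y n'" if "n = Suc n'" for n'
    using signed_seq_Suc[of y n'] that by (simp add: a_def Y_def add.commute)
  have "\<exists>c>a. card {j \<in> ?I. Y j + 1 < c} = v n \<and> (\<forall>j\<in>?I. Y j + 1 \<noteq> c) \<and> (v n = 0 \<longrightarrow> c < 1 / 2)"
  proof (cases "v n = 0")
    case True
    have "a < 1 / 2"
    proof (cases n)
      case 0
      then show ?thesis by (simp add: a_def Y_def)
    next
      case (Suc n')
      then have "v n' = 0" using Suc.prems(2)[of n'] True by auto
      then show ?thesis using y(2) Suc a_Suc by simp
    qed
    \<comment> \<open>The midpoint of \<open>a\<close> and \<open>1 / 2\<close> is admissible
      because \<open>Y j + 1 \<ge> 1 - a > 1 / 2\<close>.\<close>
    then have gt: "(a + 1 / 2) / 2 < Y j + 1" if "j \<in> ?I" for j using bounds(2)[OF that] by simp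
    have "{j \<in> ?I. Y j + 1 < (a + 1 / 2) / 2} = {}" using gt by (auto simp: not_less less_imp_le)
    moreover have "\<forall>j\<in>?I. Y j + 1 \<noteq> (a + 1 / 2) / 2" using gt by (metis less_irrefl)
    ultimately show ?thesis using True \<open>a < 1 / 2\<close>
      by (intro exI[of _ "(a + 1 / 2) / 2"]) (simp del: atLeastAtMost_iff)
  next
    case False
    have lo: "card {j \<in> ?I. Y j + 1 \<le> a} \<le> v n"
    proof (cases "\<exists>n'. n = Suc n' \<and> v n' \<noteq> 0")
      case True
      then obtain n' where n': "n = Suc n'" "v n' \<noteq> 0" by blast
      let ?S = "{j \<in> {- int n'..int n'}. signed_seq y j + 1 < y n'}"
      \<comment> \<open>Compared with the nonempty previous row only the index
        \<open>- int n\<close> can be new, since \<open>j = int n\<close> gives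
        \<open>a + 1\<close>. The strict increase of \<open>v\<close> makes room for it.\<close>
      have "{j \<in> ?I. Y j + 1 \<le> a} \<subseteq> insert (- int n) ?S"
      proof
        fix j assume j: "j \<in> {j \<in> ?I. Y j + 1 \<le> a}"
        then have "j \<noteq> int n" by (auto simp: a_def)
        show "j \<in> insert (- int n) ?S"
        proof (cases "j = - int n")
          case False
          then have j': "j \<in> {- int n'..int n'}" using j \<open>j \<noteq> int n\<close> n'(1) by auto
          then have "signed_seq y j + 1 \<noteq> y n'" using y(1) n'(1) by (auto simp: generic_seq_B_def)
          then show ?thesis using j j' a_Suc[OF n'(1)] by (simp add: Y_def)
        qed simp
      qed
      moreover have fin: "finite ?S" by (rule finite_subset[of _ "{- int n'..int n'}"]) auto
      ultimately have "card {j \<in> ?I. Y j + 1 \<le> a} \<le> card (insert (- int n) ?S)"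
        by (intro card_mono) auto
      also have "\<dots> \<le> Suc (card ?S)" using fin by (simp add: card_insert_if)
      also have "card ?S = v n'" using y(2) n'(1) by (simp add: row_count_B_def)
      also have "Suc (v n') \<le> v n" using Suc.prems(2)[of n'] n' by simp
      finally show ?thesis .
    next
      \<comment> \<open>The previous row is empty or absent, so \<open>a < 1 / 2\<close> and every
        value \<open>Y j + 1 \<ge> 1 - a\<close> exceeds \<open>a\<close>.\<close>
      case none: False
      have "a < 1 / 2"
      proof (cases n)
        case 0
        then show ?thesis by (simp add: a_def Y_def)
      next
        case (Suc n')
        then show ?thesis using none y(2) a_Suc by simp
      qed
      then have "\<not> Y j + 1 \<le> a" if "j \<in> ?I" for j using bounds(2)[OF that] by simp
      then have "{j \<in> ?I. Y j + 1 \<le> a} = {}" by blast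
      then show ?thesis by (simp only: card.empty)
    qed
    have hi: "v n \<le> card ?I" using Suc.prems(1)[of n] by simp
    have inj: "inj_on (\<lambda>j. Y j + 1) ?I"
    proof (rule inj_onI)
      fix i j assume "i \<in> ?I" "j \<in> ?I" "Y i + 1 = Y j + 1"
      then show "i = j" using mono_le[of i j] mono_le[of j i] by simp
    qed
    obtain b b' where b: "a \<le> b" "b < b'"
      "\<And>c. b < c \<Longrightarrow> c < b' \<Longrightarrow> card {j \<in> ?I. Y j + 1 < c} = v n \<and> (\<forall>j\<in>?I. Y j + 1 \<noteq> c)"
      using ex_sublevel_card[OF _ inj lo hi] by blast
    then show ?thesis using False b(3)[of "(b + b') / 2"] by (intro exI[of _ "(b + b') / 2"]) auto
  qed
  then obtain c where c: "a < c" "card {j \<in> ?I. Y j + 1 < c} = v n" "\<forall>j\<in>?I. Y j + 1 \<noteq> c"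
    "v n = 0 \<longrightarrow> c < 1 / 2" by iprover
  define y' where "y' = y(n := c)"
  have Y': "signed_seq y' j = Y j" if "j \<in> ?I" for j
    unfolding Y_def using that by (intro signed_seq_cong[of n]) (auto simp: y'_def)
  have new: "Y j < c" if "j \<in> ?I" for j using bounds(1)[OF that] c(1) by simp
  have old: "signed_seq y' j < y' k" "signed_seq y' j + 1 \<noteq> y' k" if "k < Suc n" "\<bar>j\<bar> \<le> int k" for j k
  proof -
    have j: "j \<in> ?I" using that by auto
    show "signed_seq y' j < y' k"
      using Y'[OF j] new[OF j] dom that by (cases "k = n") (auto simp: y'_def Y_def dominant_seq_B_def)
    show "signed_seq y' j + 1 \<noteq> y' k"
      using Y'[OF j] bspec[OF c(3) j] y(1) that by (cases "k = n") (auto simp: y'_def Y_def generic_seq_B_def)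
  qed
  then have "generic_seq_B (Suc n) y'" by (simp add: generic_seq_B_def dominant_seq_B_def)
  moreover have "row_count_B y' k = v k \<and> (v k = 0 \<longrightarrow> y' k < 1 / 2)" if "k < Suc n" for k
  proof (cases "k = n")
    case True
    have "{j \<in> ?I. signed_seq y' j + 1 < y' n} = {j \<in> ?I. Y j + 1 < c}"
      using Y' by (intro Collect_cong conj_cong) (auto simp: y'_def)
    then show ?thesis using c True by (simp add: row_count_B_def y'_def)
  next
    case False
    then have "row_count_B y' k = row_count_B y k"
      using that by (intro row_count_B_cong) (simp add: y'_def)
    then show ?thesis using False that y(2) by (simp add: y'_def)
  qed
  ultimately show ?case by blast
qed

section \<open>Type B regions and row vectors\<close>

text \<open>After the initial zeros the entries increase strictly, so for given \<open>n\<close>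
  such a vector amounts to its set of nonzero entries.\<close>

definition row_vectors_B :: "nat \<Rightarrow> nat list set" where
  "row_vectors_B n = {v. length v = n \<and> (\<forall>k<n. v ! k \<le> 2 * k + 1) \<and>
     (\<forall>k. Suc k < n \<longrightarrow> v ! k < v ! Suc k \<or> v ! k = 0)}"

lemma sum_odd_eq_square: "(\<Sum>k<n. 2 * k + 1) = (n :: nat)\<^sup>2"
  by (induction n) (simp_all add: power2_eq_square)

text \<open>As in type A, with signed indices: row \<open>k\<close> consists of
  \<open>2 * k + 1\<close> roots, which gives the square of the dimension as the number of positive
  roots.\<close>

lemma Cat_Shi_B_eq_row_vectors:
  "Cat_Shi 1 (pos_roots_B :: (real ^ 'n::{finite,linorder}) set) =
    (\<Sum>v\<in>row_vectors_B CARD('n). monom 1 (CARD('n)\<^sup>2 - sum_list v))"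
proof -
  let ?n = "CARD('n)"
  let ?P = "pos_roots_B :: (real, 'n) vec set"
  obtain e :: "nat \<Rightarrow> 'n" where e: "bij_betw e {..<?n} UNIV"
    "\<And>k l. k < ?n \<Longrightarrow> l < ?n \<Longrightarrow> e k < e l \<longleftrightarrow> l < k"
    using ex_decreasing_enumeration by metis
  have e_eq: "e k = e l \<longleftrightarrow> k = l" if "k < ?n" "l < ?n" for k l
    using e(1) that by (auto simp: bij_betw_def inj_on_def)
  define I where "I = (SIGMA k:{..<?n}. {- int k..int k})"
  \<comment> \<open>At \<open>j = 0\<close> the truncated index \<open>nat \<bar>j\<bar> - 1\<close>
    is 0, but the factor \<open>sgn 0 = 0\<close> removes the second term and the short root
    remains.\<close>
  define \<rho> where "\<rho> = (\<lambda>(k, j). axis (e k) 1 - of_int (sgn j) *\<^sub>R axis (e (nat \<bar>j\<bar> - 1)) 1 :: (real, 'n) vec)"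
  define y where "y x k = x $ e k" for x :: "(real, 'n) vec" and k
  define f where "f x = map (row_count_B (y x)) [0..<?n]" for x
  have in_I: "(k, j) \<in> I \<longleftrightarrow> k < ?n \<and> \<bar>j\<bar> \<le> int k" for k j by (auto simp: I_def)
  have surj_e: "\<exists>k<?n. e k = i" for i
    using e(1) by (metis UNIV_I bij_betw_imp_surj_on imageE lessThan_iff)
  have \<rho>: "\<rho> (k, 0) = axis (e k) 1" "\<rho> (k, int l + 1) = axis (e k) 1 - axis (e l) 1"
    "\<rho> (k, - (int l + 1)) = axis (e k) 1 + axis (e l) 1" for k l
  proof -
    have "nat (1 + int l) - Suc 0 = l" "nat \<bar>- 1 - int l\<bar> - 1 = l" "sgn (- 1 - int l) = - 1" by auto
    then show "\<rho> (k, 0) = axis (e k) 1" "\<rho> (k, int l + 1) = axis (e k) 1 - axis (e l) 1"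
      "\<rho> (k, - (int l + 1)) = axis (e k) 1 + axis (e l) 1"
      by (simp_all add: \<rho>_def add.commute)
  qed
  have P: "?P = \<rho> ` I"
  proof
    show "?P \<subseteq> \<rho> ` I"
    proof
      fix \<alpha> assume "\<alpha> \<in> ?P"
      then consider i j where "\<alpha> = axis i 1 - axis j 1" "i < j"
        | i j where "\<alpha> = axis i 1 + axis j 1" "i < j" | i where "\<alpha> = axis i 1"
        by (auto simp: pos_roots_B_def)
      then show "\<alpha> \<in> \<rho> ` I"
      proof cases
        case (1 i j)
        obtain k l where "k < ?n" "e k = i" "l < ?n" "e l = j" using surj_e by metis
        then show ?thesis using 1 e(2)[of k l] \<rho>(2)
          by (intro image_eqI[of _ _ "(k, int l + 1)"]) (auto simp: in_I)
      next
        case (2 i j)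
        obtain k l where "k < ?n" "e k = i" "l < ?n" "e l = j" using surj_e by metis
        then show ?thesis using 2 e(2)[of k l] \<rho>(3)[of k l]
          by (intro image_eqI[of _ _ "(k, - (int l + 1))"]) (auto simp: in_I)
      next
        case (3 i)
        obtain k where "k < ?n" "e k = i" using surj_e by metis
        then show ?thesis using 3 \<rho>(1) by (intro image_eqI[of _ _ "(k, 0)"]) (auto simp: in_I)
      qed
    qed
    show "\<rho> ` I \<subseteq> ?P"
    proof (rule image_subsetI)
      fix p assume "p \<in> I"
      then obtain k j where p: "p = (k, j)" "k < ?n" "\<bar>j\<bar> \<le> int k" by (auto simp: I_def)
      define l where "l = nat \<bar>j\<bar> - 1"
      consider "j = 0" | "j = int l + 1" "l < k" | "j = - (int l + 1)" "l < k"
        using p(3) unfolding l_def by linarith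
      then show "\<rho> p \<in> ?P"
      proof cases
        case 1
        then show ?thesis using \<rho>(1) p(1) by (auto simp: pos_roots_B_def)
      next
        case 2
        then have "e k < e l" using e(2) p by simp
        then show ?thesis unfolding p(1) 2(1) \<rho>(2) by (auto simp: pos_roots_B_def)
      next
        case 3
        then have "e k < e l" using e(2) p by simp
        then show ?thesis unfolding p(1) 3(1) \<rho>(3) by (auto simp: pos_roots_B_def)
      qed
    qed
  qed
  have inner: "\<rho> (k, j) \<bullet> x = y x k - signed_seq (y x) j" for k j x
    by (simp add: \<rho>_def y_def inner_diff_left inner_axis' signed_seq_def)
  have inj: "inj_on \<rho> I"
  proof (rule inj_onI, clarify)
    fix k j k' j' assume kj: "(k, j) \<in> I" "(k', j') \<in> I" and eq: "\<rho> (k, j) = \<rho> (k', j')"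
    have c: "\<rho> (k, j) $ e i = (if i = k then 1 else if j = int i + 1 then -1 else if j = - (int i + 1) then 1 else 0)"
      if "(k, j) \<in> I" "i < ?n" for k j i
    proof -
      have "k < ?n" "nat \<bar>j\<bar> - 1 < ?n" using that(1) by (auto simp: in_I)
      then have "\<rho> (k, j) $ e i = (if i = k then 1 else 0) - of_int (sgn j) * (if i = nat \<bar>j\<bar> - 1 then 1 else 0)"
        using that(2) e_eq[of i k] e_eq[of i "nat \<bar>j\<bar> - 1"] by (auto simp: \<rho>_def axis_def)
      then show ?thesis using that(1) by (cases j "0 :: int" rule: linorder_cases) (auto simp: in_I)
    qed
    have kn: "k < ?n" "k' < ?n" "\<bar>j\<bar> \<le> int k" "\<bar>j'\<bar> \<le> int k'" using kj by (auto simp: in_I)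
    \<comment> \<open>The index \<open>k\<close> is the last one with a nonzero coordinate, because
      \<open>\<bar>j\<bar> \<le> int k\<close> reaches only indices below \<open>k\<close>. The
      coordinates below \<open>k\<close> then reveal \<open>j\<close>.\<close>
    have "k = k'" using c[OF kj(1), of k] c[OF kj(2), of k] c[OF kj(1), of k'] c[OF kj(2), of k'] kn eq
      by (auto split: if_splits)
    moreover have "j = j'"
    proof -
      have same: "(j = int i + 1 \<longleftrightarrow> j' = int i + 1) \<and> (j = - (int i + 1) \<longleftrightarrow> j' = - (int i + 1))"
        if "i < k" for i
      proof -
        have i: "i < ?n" "i \<noteq> k" "i \<noteq> k'" using that kn(1) \<open>k = k'\<close> by auto
        let ?g = "\<lambda>j. if j = int i + 1 then -1 else if j = - (int i + 1) then 1 else 0 :: real"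
        have "?g j = ?g j'"
          using c[OF kj(1) i(1)] c[OF kj(2) i(1)] unfolding eq if_not_P[OF i(2)] if_not_P[OF i(3)]
          by (rule trans[OF sym])
        then show ?thesis by (simp split: if_splits)
      qed
      have ex: "\<exists>l<k. i = int l + 1 \<or> i = - (int l + 1)" if "i \<noteq> 0" "\<bar>i\<bar> \<le> int k" for i
      proof (cases "0 < i")
        case True
        then show ?thesis using that by (intro exI[of _ "nat i - 1"]) auto
      next
        case False
        then show ?thesis using that by (intro exI[of _ "nat (- i) - 1"]) auto
      qed
      show ?thesis
      proof (cases "j = 0")
        case True
        have "j' = 0"
        proof (rule ccontr)
          assume "j' \<noteq> 0"
          then obtain l where "l < k" "j' = int l + 1 \<or> j' = - (int l + 1)"
            using ex kn(4) \<open>k = k'\<close> by blast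
          then show False using same[of l] True by auto
        qed
        then show ?thesis using True by simp
      next
        case False
        then obtain l where "l < k" "j = int l + 1 \<or> j = - (int l + 1)" using ex kn(3) by blast
        then show ?thesis using same[of l] by auto
      qed
    qed
    ultimately show "k = k' \<and> j = j'" by simp
  qed
  have off: "x \<in> off_walls 1 ?P \<longleftrightarrow> generic_seq_B ?n (y x)" for x
  proof -
    have "x \<in> off_walls 1 ?P \<longleftrightarrow> (\<forall>p\<in>I. 0 < \<rho> p \<bullet> x \<and> \<rho> p \<bullet> x \<noteq> 1)"
      unfolding off_walls_def P by auto
    also have "\<dots> \<longleftrightarrow> (\<forall>k<?n. \<forall>j. \<bar>j\<bar> \<le> int k \<longrightarrow> signed_seq (y x) j < y x k \<and> signed_seq (y x) j + 1 \<noteq> y x k)"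
    proof -
      have "0 < \<rho> (k, j) \<bullet> x \<and> \<rho> (k, j) \<bullet> x \<noteq> 1 \<longleftrightarrow>
          signed_seq (y x) j < y x k \<and> signed_seq (y x) j + 1 \<noteq> y x k" for k j
        unfolding inner by auto
      moreover have "(\<forall>p\<in>I. Q p) \<longleftrightarrow> (\<forall>k<?n. \<forall>j. \<bar>j\<bar> \<le> int k \<longrightarrow> Q (k, j))" for Q
        using in_I by force
      ultimately show ?thesis by simp
    qed
    also have "\<dots> \<longleftrightarrow> generic_seq_B ?n (y x)"
      by (auto simp: generic_seq_B_def dominant_seq_B_def)
    finally show ?thesis .
  qed
  have card_I: "card I = ?n\<^sup>2"
  proof -
    have "card I = (\<Sum>k<?n. 2 * k + 1)" unfolding I_def
      by (subst card_SigmaI) (auto intro!: sum.cong)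
    then show ?thesis using sum_odd_eq_square by simp
  qed
  have crossed: "real t < \<rho> (k, j) \<bullet> x \<longleftrightarrow> signed_seq (y x) j + 1 < y x k" if "t \<in> {1..1}" for t k j x
    using that unfolding inner by auto
  have "Cat_Shi 1 ?P = (\<Sum>v\<in>f ` off_walls 1 ?P. monom 1 (1 * card I - sum_list v))"
  proof (rule Cat_Shi_eq_sum[OF le_refl _ P inj])
    show "finite I" by (simp add: I_def)
    show "c = 1" if "\<alpha> \<in> ?P" "\<beta> \<in> ?P" "0 < c" "\<alpha> = c *\<^sub>R \<beta>" for \<alpha> \<beta> :: "(real, 'n) vec" and c
    proof (rule no_parallel_roots[OF _ that])
      fix \<alpha> :: "(real, 'n) vec" assume "\<alpha> \<in> ?P"
      then consider i j where "\<alpha> = axis i 1 - axis j 1" "i < j"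
        | i j where "\<alpha> = axis i 1 + axis j 1" "i < j" | i where "\<alpha> = axis i 1"
        by (auto simp: pos_roots_B_def)
      then have "(\<forall>i. \<alpha> $ i \<in> {-1, 0, 1}) \<and> (\<exists>i. \<alpha> $ i = 1)"
      proof cases
        case (1 i j)
        then have "\<alpha> $ i = 1" by (simp add: axis_def)
        then show ?thesis using 1 by (auto simp: axis_def)
      next
        case (2 i j)
        then have "\<alpha> $ i = 1" by (simp add: axis_def)
        then show ?thesis using 2 by (auto simp: axis_def)
      next
        case (3 i)
        then have "\<alpha> $ i = 1" by (simp add: axis_def)
        then show ?thesis using 3 by (auto simp: axis_def)
      qed
      then show "(\<forall>i. \<alpha> $ i \<in> {-1, 0, 1}) \<and> \<alpha> \<noteq> 0" by auto
    qed
    show "f x = f x' \<longleftrightarrow> (\<forall>i\<in>I. \<forall>t\<in>{1..1}. real t < \<rho> i \<bullet> x \<longleftrightarrow> real t < \<rho> i \<bullet> x')"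
      if "x \<in> off_walls 1 ?P" "x' \<in> off_walls 1 ?P" for x x'
    proof -
      have gen: "generic_seq_B ?n (y x)" "generic_seq_B ?n (y x')" using that off by auto
      have "f x = f x' \<longleftrightarrow> (\<forall>k\<in>{..<?n}. row_count_B (y x) k = row_count_B (y x') k)"
        by (auto simp: f_def)
      also have "\<dots> \<longleftrightarrow> (\<forall>k\<in>{..<?n}. \<forall>j\<in>{- int k..int k}.
          signed_seq (y x) j + 1 < y x k \<longleftrightarrow> signed_seq (y x') j + 1 < y x' k)"
      proof (intro ball_cong refl)
        fix k assume k: "k \<in> {..<?n}"
        show "row_count_B (y x) k = row_count_B (y x') k \<longleftrightarrow> (\<forall>j\<in>{- int k..int k}.
          signed_seq (y x) j + 1 < y x k \<longleftrightarrow> signed_seq (y x') j + 1 < y x' k)"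
        proof (rule iffI)
          assume "row_count_B (y x) k = row_count_B (y x') k"
          then show "\<forall>j\<in>{- int k..int k}.
              signed_seq (y x) j + 1 < y x k \<longleftrightarrow> signed_seq (y x') j + 1 < y x' k"
            using row_counts_determine_B[OF gen] k by blast
        next
          assume h: "\<forall>j\<in>{- int k..int k}.
              signed_seq (y x) j + 1 < y x k \<longleftrightarrow> signed_seq (y x') j + 1 < y x' k"
          show "row_count_B (y x) k = row_count_B (y x') k"
            unfolding row_count_B_def
            by (intro arg_cong[of _ _ card] Collect_cong conj_cong refl) (use h in blast)
        qed
      qed
      also have "\<dots> \<longleftrightarrow> (\<forall>i\<in>I. \<forall>t\<in>{1..1}. real t < \<rho> i \<bullet> x \<longleftrightarrow> real t < \<rho> i \<bullet> x')"
        unfolding I_def split_paired_Ball_Sigma using crossed by simp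
      finally show ?thesis .
    qed
    show "sum_list (f x) = card {(i, t). i \<in> I \<and> t \<in> {1..1} \<and> real t < \<rho> i \<bullet> x}" for x
    proof -
      let ?S = "SIGMA k:{..<?n}. {j \<in> {- int k..int k}. signed_seq (y x) j + 1 < y x k}"
      have fin: "finite {j \<in> {- int k..int k}. signed_seq (y x) j + 1 < y x k}" for k
        by (rule finite_subset[of _ "{- int k..int k}"]) auto
      have "sum_list (f x) = (\<Sum>k<?n. row_count_B (y x) k)"
        by (simp add: f_def interv_sum_list_conv_sum_set_nat atLeast0LessThan)
      also have "\<dots> = card ?S"
        unfolding row_count_B_def by (rule card_SigmaI[symmetric]) (rule finite_lessThan, rule ballI, rule fin)
      also have "\<dots> = card {(i, t). i \<in> I \<and> t \<in> {1..1} \<and> real t < \<rho> i \<bullet> x}"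
        by (rule bij_betw_same_card[of "\<lambda>p. (p, 1)"], rule bij_betwI[of _ _ _ fst])
          (auto simp: I_def inner algebra_simps)
      finally show ?thesis .
    qed
  qed
  also have "f ` off_walls 1 ?P = row_vectors_B ?n"
  proof
    show "f ` off_walls 1 ?P \<subseteq> row_vectors_B ?n"
    proof
      fix v assume "v \<in> f ` off_walls 1 ?P"
      then obtain x where x: "generic_seq_B ?n (y x)" "v = f x" using off by auto
      then have "row_count_B (y x) k < row_count_B (y x) (Suc k) \<or> row_count_B (y x) k = 0"
        if "Suc k < ?n" for k
        using row_count_B_strict_mono[of ?n "y x" k] that by (auto simp: generic_seq_B_def)
      moreover have "row_count_B (y x) k \<le> 2 * k + 1" for k by (rule row_count_B_le)
      ultimately show "v \<in> row_vectors_B ?n" using x(2) by (simp add: row_vectors_B_def f_def)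
    qed
    show "row_vectors_B ?n \<subseteq> f ` off_walls 1 ?P"
    proof
      fix v assume v: "v \<in> row_vectors_B ?n"
      then obtain z where z: "generic_seq_B ?n z" "\<forall>k<?n. row_count_B z k = v ! k"
        using ex_seq_row_counts_B[of ?n "(!) v"] by (auto simp: row_vectors_B_def)
      define x :: "(real, 'n) vec" where "x = (\<chi> i. z (the_inv_into {..<?n} e i))"
      have yz: "y x k = z k" if "k < ?n" for k
        using e(1) that by (simp add: y_def x_def the_inv_into_f_f bij_betw_def)
      have Yz: "signed_seq (y x) j = signed_seq z j" if "k < ?n" "\<bar>j\<bar> \<le> int k" for j k
        using that yz by (intro signed_seq_cong[of k]) auto
      have "generic_seq_B ?n (y x)"
        using z(1) Yz yz by (simp add: generic_seq_B_def dominant_seq_B_def)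
      moreover have "f x = v"
      proof (rule nth_equalityI)
        show "length (f x) = length v" using v by (simp add: f_def row_vectors_B_def)
        fix k assume "k < length (f x)"
        then have k: "k < ?n" by (simp add: f_def)
        have "row_count_B (y x) k = row_count_B z k" by (rule row_count_B_cong) (use k yz in auto)
        then show "f x ! k = v ! k" using z(2) k by (simp add: f_def)
      qed
      ultimately show "v \<in> f ` off_walls 1 ?P" using off by blast
    qed
  qed
  finally show ?thesis by (simp add: card_I)
qed

subsection \<open>Type B Catalan paths\<close>

lemma count_list_take_Suc:
  "i < length w \<Longrightarrow> count_list (take (Suc i) w) s = count_list (take i w) s + (if w ! i = s then 1 else 0)"
  by (simp add: take_Suc_conv_app_nth)

lemma count_list_take_mono: "i \<le> j \<Longrightarrow> count_list (take i w) s \<le> count_list (take j w) s"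
  using take_add[of i "j - i" w] by simp

lemma count_list_take_diff_le: "i \<le> j \<Longrightarrow> count_list (take j w) s \<le> count_list (take i w) s + (j - i)"
  using take_add[of i "j - i" w] count_le_length[of "take (j - i) (drop i w)" s] by simp linarith

lemma count_East_North: "i \<le> length w \<Longrightarrow> count_list (take i w) East + count_list (take i w) North = i"
proof (induction i)
  case (Suc i)
  then show ?case by (cases "w ! i") (simp_all add: count_list_take_Suc)
qed simp

lemma catalan_paths_B_iff:
  "w \<in> catalan_paths_B n \<longleftrightarrow> length w = 2 * n \<and> (\<forall>i\<le>2 * n. 2 * count_list (take i w) East \<le> i)"
proof -
  have "count_list (take i w) East \<le> count_list (take i w) North \<longleftrightarrow> 2 * count_list (take i w) East \<le> i"
    if "length w = 2 * n" "i \<le> 2 * n" for i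
    using count_East_North[of i w] that by linarith
  then show ?thesis by (auto simp: catalan_paths_B_def path_vertex_def)
qed

lemma mem_path_curve_iff:
  "(x, y) \<in> path_curve w \<longleftrightarrow> (\<exists>i<length w.
     if w ! i = East
     then y = real (count_list (take i w) North) \<and>
       real (count_list (take i w) East) \<le> x \<and> x \<le> real (count_list (take i w) East) + 1
     else x = real (count_list (take i w) East) \<and>
       real (count_list (take i w) North) \<le> y \<and> y \<le> real (count_list (take i w) North) + 1)"
proof -
  have h: "(x, y) \<in> closed_segment (X, Y) (1 + X, Y) \<longleftrightarrow> y = Y \<and> X \<le> x \<and> x \<le> X + 1" for X Y :: real
  proof
    assume "y = Y \<and> X \<le> x \<and> x \<le> X + 1"
    then show "(x, y) \<in> closed_segment (X, Y) (1 + X, Y)"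
      unfolding closed_segment_def by (intro CollectI exI[of _ "x - X"]) (auto simp: algebra_simps)
  qed (auto simp: closed_segment_def algebra_simps)
  have v: "(x, y) \<in> closed_segment (X, Y) (X, 1 + Y) \<longleftrightarrow> x = X \<and> Y \<le> y \<and> y \<le> Y + 1" for X Y :: real
  proof
    assume "x = X \<and> Y \<le> y \<and> y \<le> Y + 1"
    then show "(x, y) \<in> closed_segment (X, Y) (X, 1 + Y)"
      unfolding closed_segment_def by (intro CollectI exI[of _ "y - Y"]) (auto simp: algebra_simps)
  qed (auto simp: closed_segment_def algebra_simps)
  have "(x, y) \<in> closed_segment (map_prod real real (path_vertex w i)) (map_prod real real (path_vertex w (Suc i)))
    \<longleftrightarrow> (if w ! i = East
     then y = real (count_list (take i w) North) \<and>
       real (count_list (take i w) East) \<le> x \<and> x \<le> real (count_list (take i w) East) + 1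
     else x = real (count_list (take i w) East) \<and>
       real (count_list (take i w) North) \<le> y \<and> y \<le> real (count_list (take i w) North) + 1)"
    if "i < length w" for i
    using that by (cases "w ! i") (simp_all add: path_vertex_def count_list_take_Suc h v add.commute)
  then show ?thesis unfolding path_curve_def by auto
qed

text \<open>
  The path meets the antidiagonal \<open>x + y = a + b + 1\<close> weakly to the left of \<open>(a, b + 1)\<close> if and only
  if the square with lower left corner \<open>(a, b)\<close> lies to its right.
\<close>

lemma unit_square_in_path_region_iff:
  assumes w: "w \<in> catalan_paths_B n" and ab: "a + b < 2 * n"
  shows "unit_square a b \<inter> {(x, y). x + y \<le> 2 * real n} \<subseteq> path_region n w \<longleftrightarrow>
    a < b \<and> count_list (take (a + b + 1) w) East \<le> a"
proof -
  define E where "E i = count_list (take i w) East" for i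
  define N where "N i = count_list (take i w) North" for i
  have len: "length w = 2 * n" using w by (simp add: catalan_paths_B_iff)
  have EN: "E i + N i = i" if "i \<le> 2 * n" for i
    using count_East_North[of i w] that len by (simp add: E_def N_def)
  have ab': "real a + real b + 1 \<le> 2 * real n" using ab by linarith
  show ?thesis
  proof
    assume sub: "unit_square a b \<inter> {(x, y). x + y \<le> 2 * real n} \<subseteq> path_region n w"
    \<comment> \<open>Two corners on \<open>x + y = a + b + 1\<close> are tested, both within the
      antidiagonal bound: the lower right one yields \<open>a < b\<close>, the upper left one a
      point of the path.\<close>
    have "(real a + 1, real b) \<in> path_region n w"
      by (rule subsetD[OF sub]) (use ab' in \<open>simp add: unit_square_def\<close>)
    then have "a < b" by (simp add: path_region_def)
    have "(real a, real b + 1) \<in> path_region n w"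
      by (rule subsetD[OF sub]) (use ab' in \<open>simp add: unit_square_def\<close>)
    then obtain x' where x': "x' \<le> real a" "(x', real b + 1) \<in> path_curve w"
      by (auto simp: path_region_def)
    then obtain i where i: "i < 2 * n" "if w ! i = East
        then real b + 1 = real (N i) \<and> real (E i) \<le> x' \<and> x' \<le> real (E i) + 1
        else x' = real (E i) \<and> real (N i) \<le> real b + 1 \<and> real b + 1 \<le> real (N i) + 1"
      unfolding mem_path_curve_iff len E_def N_def by blast
    \<comment> \<open>The point of the path is moved to a vertex at the same height: to the start of
      an east step, or to the matching end of a north step.\<close>
    have "\<exists>j\<le>2 * n. N j = b + 1 \<and> E j \<le> a"
    proof (cases "w ! i = East")
      case True
      then have "real (N i) = real (b + 1)" "real (E i) \<le> real a" using i(2) x'(1) by auto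
      then show ?thesis using i(1) by (intro exI[of _ i]) linarith
    next
      case False
      then have *: "real (E i) \<le> real a" "real (N i) \<le> real (b + 1)" "real (b + 1) \<le> real (N i + 1)"
        using i(2) x'(1) by auto
      have "w ! i = North" using False by (cases "w ! i") auto
      then have "E (Suc i) = E i" "N (Suc i) = N i + 1"
        using count_list_take_Suc[of i w] i(1) len by (simp_all add: E_def N_def)
      moreover have "N i = b + 1 \<or> N i = b" using * by linarith
      ultimately show ?thesis using * i(1)
        by (cases "N i = b + 1") (force intro: exI[of _ i], force intro: exI[of _ "Suc i"])
    qed
    then obtain j where j: "j \<le> 2 * n" "N j = b + 1" "E j \<le> a" by blast
    \<comment> \<open>From vertex \<open>j\<close>, where \<open>j = E j + b + 1\<close>, only
      \<open>a - E j\<close> steps remain up to step \<open>a + b + 1\<close>.\<close>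
    have "E (a + b + 1) \<le> E j + (a + b + 1 - j)"
      using count_list_take_diff_le[of j "a + b + 1" w East] EN[OF j(1)] j by (simp add: E_def)
    then have "E (a + b + 1) \<le> a" using EN[OF j(1)] j by linarith
    then show "a < b \<and> count_list (take (a + b + 1) w) East \<le> a" using \<open>a < b\<close> by (simp add: E_def)
  next
    assume h: "a < b \<and> count_list (take (a + b + 1) w) East \<le> a"
    have Nab: "b < N (a + b + 1)" using EN[of "a + b + 1"] h ab by (simp add: E_def)
    \<comment> \<open>The step before the first vertex above height \<open>b\<close> is the north
      step from \<open>b\<close> to \<open>b + 1\<close>. It covers all heights of the square and
      lies weakly to its left.\<close>
    define i where "i = (LEAST i. b < N i)"
    have i: "b < N i" "i \<le> a + b + 1"
      unfolding i_def using LeastI[of "\<lambda>i. b < N i", OF Nab] Least_le[of "\<lambda>i. b < N i", OF Nab] .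
    have below: "N j \<le> b" if "j < i" for j
      using not_less_Least[of j "\<lambda>i. b < N i"] that by (simp add: i_def)
    have "i \<noteq> 0" using i(1) by (rule contrapos_pn) (simp add: N_def)
    then obtain k where k: "i = Suc k" by (cases i) auto
    have k_len: "k < length w" using i(2) k ab len by simp
    have Nk: "N k = b" "w ! k = North"
      using i(1) below[of k] count_list_take_Suc[OF k_len, of North] k by (auto simp: N_def split: if_splits)
    have Ek: "E k \<le> a"
      using h count_list_take_mono[of k "a + b + 1" w East] i(2) k by (simp add: E_def)
    show "unit_square a b \<inter> {(x, y). x + y \<le> 2 * real n} \<subseteq> path_region n w"
    proof clarify
      fix x y assume xy: "(x, y) \<in> unit_square a b" "x + y \<le> 2 * real n"
      have b: "real a \<le> x" "x \<le> real a + 1" "real b \<le> y" "y \<le> real b + 1"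
        using xy(1) by (auto simp: unit_square_def)
      have "(real (E k), y) \<in> path_curve w"
        unfolding mem_path_curve_iff using k_len Nk b by (intro exI[of _ k]) (simp add: E_def N_def)
      moreover have "real (E k) \<le> x" using Ek b(1) by linarith
      moreover have "x \<le> y" using h b by linarith
      ultimately show "(x, y) \<in> path_region n w" using xy(2) by (auto simp: path_region_def)
    qed
  qed
qed

section \<open>The area in terms of east steps\<close>

text \<open>Double counting: an east step at position \<open>p\<close> is seen by the
  \<open>k - p\<close> prefixes of lengths \<open>p + 1\<close> to \<open>k\<close>.\<close>

lemma sum_count_East:
  "k \<le> length w \<Longrightarrow> (\<Sum>i\<in>{1..k}. count_list (take i w) East) = (\<Sum>p<k. if w ! p = East then k - p else 0)"
proof (induction k)
  case (Suc k)
  have count: "(\<Sum>p<j. if w ! p = East then 1 else 0) = count_list (take j w) East" if "j \<le> length w" for j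
    using that by (induction j) (simp_all add: count_list_take_Suc)
  have "(\<Sum>p<Suc k. if w ! p = East then Suc k - p else 0) =
      (\<Sum>p<Suc k. (if w ! p = East then k - p else 0) + (if w ! p = East then 1 else 0))"
    by (rule sum.cong) (auto simp: Suc_diff_le)
  also have "\<dots> = (\<Sum>p<k. if w ! p = East then k - p else 0) + count_list (take (Suc k) w) East"
    using Suc.prems by (simp only: sum.distrib count) simp
  also have "\<dots> = (\<Sum>i\<in>{1..Suc k}. count_list (take i w) East)" using Suc by simp
  finally show ?case by simp
qed simp

text \<open>Of the \<open>n\<^sup>2\<close> squares above the diagonal with
  \<open>a + b < 2 * n\<close>, those in \<open>U\<close> lie left of the path. On the antidiagonal
  \<open>x + y = i\<close> there are \<open>E i\<close> of them, and these numbers are summed over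
  \<open>i\<close>.\<close>

lemma area_B_eq:
  assumes w: "w \<in> catalan_paths_B n"
  shows "area_B n w = n\<^sup>2 - (\<Sum>p<2 * n. if w ! p = East then 2 * n - p else 0)"
proof -
  define E where "E i = count_list (take i w) East" for i
  define A where "A = {(a, b). a < b \<and> a + b < 2 * n}"
  define U where "U = {(a, b). a < b \<and> a + b < 2 * n \<and> a < E (a + b + 1)}"
  have len: "length w = 2 * n" and ballot: "\<And>i. i \<le> 2 * n \<Longrightarrow> 2 * E i \<le> i"
    using w by (auto simp: catalan_paths_B_iff E_def)
  have A_eq: "A = (SIGMA a:{..<n}. {a<..<2 * n - a})" by (auto simp: A_def)
  have "card A = (\<Sum>a<n. 2 * n - a - Suc a)" unfolding A_eq by simp
  also have "\<dots> = (\<Sum>a<n. 2 * (n - Suc a) + 1)" by (rule sum.cong) auto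
  also have "\<dots> = n\<^sup>2" using sum.nat_diff_reindex[of "\<lambda>k. 2 * k + 1" n] sum_odd_eq_square[of n] by simp
  finally have card_A: "card A = n\<^sup>2" .
  have finA: "finite A" unfolding A_eq by simp
  have UA: "U \<subseteq> A" by (auto simp: U_def A_def)
  have "card U = card (SIGMA i:{1..2 * n}. {..<E i})"
  proof (rule bij_betw_same_card[of "\<lambda>(a, b). (a + b + 1, a)"], rule bij_betwI[of _ _ _ "\<lambda>(i, a). (a, i - 1 - a)"])
    show "(\<lambda>(i, a). (a, i - 1 - a)) \<in> (SIGMA i:{1..2 * n}. {..<E i}) \<rightarrow> U"
    proof clarify
      fix i a assume "i \<in> {1..2 * n}" "a < E i"
      \<comment> \<open>The path stays above the diagonal, so each \<open>a < E i\<close> belongs to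
        a square with \<open>a < b\<close>.\<close>
      moreover from this have "2 * a + 2 \<le> i" using ballot[of i] by simp
      moreover from this have "a + (i - 1 - a) + 1 = i" by simp
      ultimately show "(a, i - 1 - a) \<in> U" by (auto simp: U_def)
    qed
    fix p assume "p \<in> (SIGMA i:{1..2 * n}. {..<E i})"
    then obtain i a where "p = (i, a)" "i \<in> {1..2 * n}" "a < E i" by auto
    moreover from this have "2 * a + 2 \<le> i" using ballot[of i] by simp
    ultimately show "(case case p of (i, a) \<Rightarrow> (a, i - 1 - a) of (a, b) \<Rightarrow> (a + b + 1, a)) = p" by simp
  qed (auto simp: U_def)
  also have "\<dots> = (\<Sum>i\<in>{1..2 * n}. E i)" by simp
  also have "\<dots> = (\<Sum>p<2 * n. if w ! p = East then 2 * n - p else 0)"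
    using sum_count_East[of "2 * n" w] len by (simp add: E_def)
  finally have card_U: "card U = (\<Sum>p<2 * n. if w ! p = East then 2 * n - p else 0)" .
  have "{(a, b). a + b < 2 * n \<and> unit_square a b \<inter> {(x, y). x + y \<le> 2 * real n} \<subseteq> path_region n w} = A - U"
  proof (intro set_eqI)
    fix p :: "nat \<times> nat"
    obtain a b where p: "p = (a, b)" by (cases p)
    show "p \<in> {(a, b). a + b < 2 * n \<and> unit_square a b \<inter> {(x, y). x + y \<le> 2 * real n} \<subseteq> path_region n w}
        \<longleftrightarrow> p \<in> A - U"
    proof (cases "a + b < 2 * n")
      case True
      then show ?thesis
        unfolding p mem_Collect_eq case_prod_conv unit_square_in_path_region_iff[OF w True]
        by (auto simp: A_def U_def E_def)
    qed (simp add: p A_def)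
  qed
  then have "area_B n w = card A - card U"
    unfolding area_B_def by (simp add: card_Diff_subset[OF finite_subset[OF UA finA] UA])
  then show ?thesis by (simp add: card_A card_U)
qed

section \<open>Paths and row vectors of type B\<close>

text \<open>Positions are recorded from the end as \<open>t = 2 * n - p\<close>, so a prefix of
  length \<open>i\<close> becomes the condition \<open>2 * n - i < t\<close>.\<close>

lemma count_East_eq_card:
  assumes "length w = 2 * n" "i \<le> 2 * n"
  shows "count_list (take i w) East = card {t \<in> {1..2 * n}. w ! (2 * n - t) = East \<and> 2 * n - i < t}"
proof -
  have "count_list (take j w) East = card {p \<in> {..<j}. w ! p = East}" if "j \<le> length w" for j
    using that
  proof (induction j)
    case (Suc j)
    have "{p \<in> {..<Suc j}. w ! p = East} =
        (if w ! j = East then insert j {p \<in> {..<j}. w ! p = East} else {p \<in> {..<j}. w ! p = East})"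
      by (auto simp: less_Suc_eq)
    then show ?case using Suc by (simp add: count_list_take_Suc)
  qed simp
  then have "count_list (take i w) East = card {p \<in> {..<i}. w ! p = East}" using assms by simp
  also have "\<dots> = card {t \<in> {1..2 * n}. w ! (2 * n - t) = East \<and> 2 * n - i < t}"
    by (rule bij_betw_same_card[of "\<lambda>p. 2 * n - p"], rule bij_betwI[of _ _ _ "\<lambda>t. 2 * n - t"])
      (use assms in auto)
  finally show ?thesis .
qed

text \<open>The nonzero entries of the row vector are the numbers \<open>2 n - p\<close> with an east step at position \<open>p\<close>.\<close>

lemma Cat_B_eq_row_vectors:
  "Cat_B n = (\<Sum>v\<in>row_vectors_B n. monom 1 (n\<^sup>2 - sum_list v))"
proof -
  define T where "T w = {t \<in> {1..2 * n}. w ! (2 * n - t) = East}" for w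
  define j where "j w = replicate (n - card (T w)) 0 @ sorted_list_of_set (T w)" for w
  define i where "i v = map (\<lambda>p. if 2 * n - p \<in> set v then East else North) [0..<2 * n]" for v
  have finT: "finite (T w)" for w by (simp add: T_def)
  have i_nth: "i v ! p = (if 2 * n - p \<in> set v then East else North)" if "p < 2 * n" for v p
    using that by (simp add: i_def)
  show ?thesis
    unfolding Cat_B_def
  proof (rule sum.reindex_bij_witness[of _ i j])
    fix w assume w: "w \<in> catalan_paths_B n"
    then have len: "length w = 2 * n" and ballot: "\<And>i. i \<le> 2 * n \<Longrightarrow> 2 * count_list (take i w) East \<le> i"
      by (auto simp: catalan_paths_B_iff)
    have set_j: "t \<in> set (j w) \<longleftrightarrow> t \<in> T w" if "t \<noteq> 0" for t
      using that finT by (auto simp: j_def)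
    show "i (j w) = w"
    proof (rule nth_equalityI)
      fix p assume "p < length (i (j w))"
      then have p: "p < 2 * n" by (simp add: i_def)
      have "2 * n - p \<in> set (j w) \<longleftrightarrow> w ! p = East" using p by (auto simp: set_j T_def)
      then show "i (j w) ! p = w ! p" using p by (cases "w ! p") (simp_all add: i_nth)
    qed (simp add: i_def len)
    have "sum_list (j w) = \<Sum>(T w)"
      using finT[of w] distinct_sum_list_conv_Sum[of "sorted_list_of_set (T w)"]
      by (simp add: j_def sum_list_replicate)
    also have "\<dots> = (\<Sum>t\<in>{1..2 * n}. if w ! (2 * n - t) = East then t else 0)"
      unfolding T_def by (rule sum.inter_filter) simp
    also have "\<dots> = (\<Sum>p<2 * n. if w ! p = East then 2 * n - p else 0)"
      by (rule sum.reindex_bij_witness[of _ "\<lambda>p. 2 * n - p" "\<lambda>p. 2 * n - p"]) auto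
    finally show "monom 1 (n\<^sup>2 - sum_list (j w)) = (monom 1 (area_B n w) :: int poly)"
      using area_B_eq[OF w] by simp
    define L where "L = sorted_list_of_set (T w)"
    have L: "set L = T w" "distinct L" "sorted_wrt (<) L" "length L = card (T w)"
      using finT by (simp_all add: L_def)
    have "T w = {t \<in> {1..2 * n}. w ! (2 * n - t) = East \<and> 2 * n - 2 * n < t}" by (auto simp: T_def)
    then have "card (T w) \<le> n" using count_East_eq_card[OF len, of "2 * n"] ballot[of "2 * n"] by simp
    then have len_j: "length (j w) = n" by (simp add: j_def)
    define z where "z = n - card (T w)"
    have zc: "z + length L = n" using \<open>card (T w) \<le> n\<close> L(4) by (simp add: z_def)
    have nth: "j w ! k = (if k < z then 0 else L ! (k - z))" if "k < n" for k
      using that by (auto simp: j_def L_def z_def nth_append)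
    have "j w ! k \<le> 2 * k + 1" if k: "k < n" for k
    proof (cases "k < z")
      case False
      define t where "t = L ! (k - z)"
      have kz: "k - z < length L" using k zc False by simp
      then have tT: "t \<in> T w" using L(1) nth_mem unfolding t_def by blast
      then have t: "1 \<le> t" "t \<le> 2 * n" by (auto simp: T_def)
      \<comment> \<open>The \<open>n - k\<close> entries of \<open>L\<close> from \<open>t\<close>
        onwards are east steps in the prefix of length \<open>2 * n - t + 1\<close>, to which the
        ballot condition applies.\<close>
      have "(!) L ` {k - z..<length L} \<subseteq> {s \<in> {1..2 * n}. w ! (2 * n - s) = East \<and> 2 * n - (2 * n - t + 1) < s}"
      proof
        fix s assume "s \<in> (!) L ` {k - z..<length L}"
        then obtain l where l: "k - z \<le> l" "l < length L" "s = L ! l" by auto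
        then have "s \<in> T w" using L(1) nth_mem by blast
        moreover have "t \<le> s"
          using sorted_wrt_nth_less[OF L(3), of "k - z" l] l by (cases "k - z = l") (auto simp: t_def)
        ultimately show "s \<in> {s \<in> {1..2 * n}. w ! (2 * n - s) = East \<and> 2 * n - (2 * n - t + 1) < s}"
          using t by (auto simp: T_def)
      qed
      then have "card ((!) L ` {k - z..<length L}) \<le> count_list (take (2 * n - t + 1) w) East"
        using t by (subst count_East_eq_card[OF len]) (auto intro!: card_mono)
      moreover have "card ((!) L ` {k - z..<length L}) = n - k"
        using inj_on_nth[OF L(2), of "{k - z..<length L}"] zc False by (simp add: card_image)
      moreover have "2 * n - t + 1 \<le> 2 * n" using t by simp
      ultimately have "2 * (n - k) \<le> 2 * n - t + 1" using ballot[of "2 * n - t + 1"] by linarith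
      then show ?thesis using nth[OF k] False t k by (simp add: t_def)
    qed (simp add: nth k)
    moreover have "j w ! k < j w ! Suc k \<or> j w ! k = 0" if "Suc k < n" for k
      using that nth[of k] nth[of "Suc k"] zc sorted_wrt_nth_less[OF L(3), of "k - z" "Suc k - z"]
      by (cases "k < z") auto
    ultimately show "j w \<in> row_vectors_B n" using len_j by (simp add: row_vectors_B_def)
  next
    fix v assume "v \<in> row_vectors_B n"
    then have v: "length v = n" "\<And>k. k < n \<Longrightarrow> v ! k \<le> 2 * k + 1"
      "\<And>k. Suc k < n \<Longrightarrow> v ! k < v ! Suc k \<or> v ! k = 0" by (auto simp: row_vectors_B_def)
    have bound: "t \<le> 2 * n" if t: "t \<in> set v" for t
    proof -
      obtain k where "k < n" "v ! k = t" using t v(1) by (auto simp: in_set_conv_nth)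
      then show ?thesis using v(2)[of k] by simp
    qed
    have T_i: "T (i v) = set v - {0}"
    proof (intro set_eqI)
      fix t
      show "t \<in> T (i v) \<longleftrightarrow> t \<in> set v - {0}"
        using bound[of t] i_nth[of "2 * n - t" v] by (cases "t \<in> {1..2 * n}") (auto simp: T_def)
    qed
    \<comment> \<open>Transitivity extends the condition on neighbouring entries to all pairs: if
      the middle entry is 0, so is the first.\<close>
    have "transp (\<lambda>a b :: nat. a < b \<or> a = 0)" by (auto intro!: transpI)
    then have R: "sorted_wrt (\<lambda>a b. a < b \<or> a = 0) v"
      using v by (simp add: sorted_wrt_iff_nth_Suc_transp)
    then have sorted: "sorted v" by (rule sorted_wrt_mono_rel[rotated]) auto
    define F where "F = filter (\<lambda>a. a \<noteq> 0) v"
    have "sorted_wrt (<) F" unfolding F_def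
      using sorted_wrt_filter[OF R, of "\<lambda>a. a \<noteq> 0"] by (rule sorted_wrt_mono_rel[rotated]) auto
    then have "sorted_list_of_set (set F) = F" "distinct F"
      by (auto simp: strict_sorted_iff intro!: sorted_list_of_set.idem_if_sorted_distinct)
    moreover have "T (i v) = set F" by (auto simp: T_i F_def)
    ultimately have "j (i v) = replicate (n - length F) 0 @ F" by (simp add: j_def distinct_card)
    also have "\<dots> = v" using sorted_eq_zeros_append[OF sorted] v(1) by (simp add: F_def)
    finally show "j (i v) = v" .
    show "i v \<in> catalan_paths_B n"
      unfolding catalan_paths_B_iff
    proof (intro conjI allI impI)
      show len: "length (i v) = 2 * n" by (simp add: i_def)
      fix q assume q: "q \<le> 2 * n"
      define s where "s = 2 * n - q"
      have "count_list (take q (i v)) East = card {t \<in> T (i v). s < t}"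
        unfolding count_East_eq_card[OF len q] T_def s_def by (intro arg_cong[of _ _ card]) auto
      \<comment> \<open>An entry above \<open>s\<close> at index \<open>k\<close> needs
        \<open>s < 2 * k + 1\<close>, so \<open>k\<close> is at least half of \<open>s\<close>,
        rounded up.\<close>
      also have "\<dots> \<le> card ((!) v ` {(s + 1) div 2..<n})"
      proof (intro card_mono)
        show "{t \<in> T (i v). s < t} \<subseteq> (!) v ` {(s + 1) div 2..<n}"
        proof clarify
          fix t assume t: "t \<in> T (i v)" "s < t"
          then obtain k where k: "k < n" "v ! k = t"
            using v(1) unfolding T_i by (auto simp: in_set_conv_nth)
          then have "(s + 1) div 2 \<le> k" using v(2)[of k] t(2) by linarith
          then show "t \<in> (!) v ` {(s + 1) div 2..<n}" using k by auto
        qed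
      qed simp
      also have "\<dots> \<le> n - (s + 1) div 2" using card_image_le[of "{(s + 1) div 2..<n}" "(!) v"] by simp
      finally show "2 * count_list (take q (i v)) East \<le> q" using q unfolding s_def by linarith
    qed
  qed
qed

theorem theorem3:
  fixes m :: nat
  assumes "m \<ge> 1"
  shows "Cat_Shi m (pos_roots_A :: (real ^ 'n::{finite,linorder}) set) = Cat_A m CARD('n) \<and>
         Cat_Shi 1 (pos_roots_B :: (real ^ 'n::{finite,linorder}) set) = Cat_B CARD('n)"
  using Cat_Shi_A_eq_row_vectors[OF assms, where 'n = 'n] Cat_Shi_B_eq_row_vectors[where 'n = 'n]
  by (simp only: Cat_A_eq_row_vectors Cat_B_eq_row_vectors)

end
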